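(* Let $K$ be an algebraically closed field of characteristic $p>0$ with $p\neq 2$, and let $n>3$. Let $\Phi$ be a group automorphism of $\mathrm{Aut}_0 K[x_1,\ldots,x_n]$ which fixes every element of the standard torus $T^n$, i.e. $\Phi(\sigma_\lambda)=\sigma_\lambda$ for every $\lambda=(\lambda_1,\ldots,\lambda_n)\in (K^\times)^n$, where $\sigma_\lambda$ is the automorphism $x_i\mapsto \lambda_i x_i$ ($i=1,\ldots,n$). Then there exists a linear automorphism $S\in \mathrm{GL}_n(K)$ such that the map $\varphi\mapsto S\circ\Phi(\varphi)\circ S^{-1}$ fixes every (origin-preserving) elementary automorphism.
   Context: $\mathrm{Aut}_0 K[x_1,\ldots,x_n]$ denotes the group (under composition) of $K$-algebra automorphisms $\varphi$ of the polynomial algebra $K[x_1,\ldots,x_n]$ that preserve the origin, i.e. each $\varphi(x_i)$ has zero constant term. $\mathrm{GL}_n(K)\subset \mathrm{Aut}_0K[x_1,\ldots,x_n]$ is the subgroup of linear automorphisms $x_i\mapsto \sum_j a_{ij}x_j$ with $(a_{ij})$ invertible. An (origin-preserving) elementary automorphism is one of the form $x_i\mapsto x_i+P(x_1,\ldots,\hat{x}_i,\ldots,x_n)$, $x_k\mapsto x_k$ for $k\neq i$, where $P$ does not depend on $x_i$ and has zero constant term. *)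

theory Defs
  imports "HOL-Library.Poly_Mapping" "HOL-Computational_Algebra.Polynomial" "HOL-Algebra.Group"
begin

(* Multivariate polynomials over 'a in variables x_0, x_1, ... (0-based indices):
   a polynomial is a finitely supported map from monomials (exponent vectors) to coefficients. *)
type_synonym 'a mpoly = "(nat \<Rightarrow>\<^sub>0 nat) \<Rightarrow>\<^sub>0 'a"

definition mVar :: "nat \<Rightarrow> 'a::comm_ring_1 mpoly" where
  "mVar i = Poly_Mapping.single (Poly_Mapping.single i 1) 1"

definition mConst :: "'a::comm_ring_1 \<Rightarrow> 'a mpoly" where
  "mConst c = Poly_Mapping.single 0 c"

definition const_coeff :: "'a::comm_ring_1 mpoly \<Rightarrow> 'a" where
  "const_coeff p = Poly_Mapping.lookup p 0"

definition mvars :: "'a::comm_ring_1 mpoly \<Rightarrow> nat set" where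
  "mvars p = (\<Union>m \<in> Poly_Mapping.keys p. Poly_Mapping.keys m)"

definition Pn :: "nat \<Rightarrow> 'a::comm_ring_1 mpoly set" where
  "Pn n = {p. mvars p \<subseteq> {..<n}}"

(* K-algebra endomorphisms of K[x_1..x_n]; they act as the identity outside Pn n
   (so that equality of automorphisms is equality of functions) *)
definition alg_endo :: "nat \<Rightarrow> ('a::comm_ring_1 mpoly \<Rightarrow> 'a mpoly) \<Rightarrow> bool" where
  "alg_endo n h \<longleftrightarrow> h ` Pn n \<subseteq> Pn n
     \<and> (\<forall>p\<in>Pn n. \<forall>q\<in>Pn n. h (p + q) = h p + h q)
     \<and> (\<forall>p\<in>Pn n. \<forall>q\<in>Pn n. h (p * q) = h p * h q)
     \<and> (\<forall>c. h (mConst c) = mConst c)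
     \<and> (\<forall>p. p \<notin> Pn n \<longrightarrow> h p = p)"

definition Aut0 :: "nat \<Rightarrow> ('a::comm_ring_1 mpoly \<Rightarrow> 'a mpoly) set" where
  "Aut0 n = {h. alg_endo n h \<and> bij_betw h (Pn n) (Pn n)
               \<and> (\<forall>i<n. const_coeff (h (mVar i)) = 0)}"

definition Aut0_group :: "nat \<Rightarrow> ('a::comm_ring_1 mpoly \<Rightarrow> 'a mpoly) monoid" where
  "Aut0_group n = \<lparr>carrier = Aut0 n, mult = (\<circ>), one = id\<rparr>"

definition subst_hom :: "nat \<Rightarrow> (nat \<Rightarrow> 'a::comm_ring_1 mpoly) \<Rightarrow> 'a mpoly \<Rightarrow> 'a mpoly" where
  "subst_hom n F p = (if p \<in> Pn n then
      (\<Sum>m\<in>Poly_Mapping.keys p. mConst (Poly_Mapping.lookup p m) * (\<Prod>i\<in>Poly_Mapping.keys m. F i ^ Poly_Mapping.lookup m i))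
    else p)"

definition torus_elt :: "nat \<Rightarrow> (nat \<Rightarrow> 'a::comm_ring_1) \<Rightarrow> 'a mpoly \<Rightarrow> 'a mpoly" where
  "torus_elt n lam = subst_hom n (\<lambda>i. mConst (lam i) * mVar i)"

definition elementary :: "nat \<Rightarrow> ('a::comm_ring_1 mpoly \<Rightarrow> 'a mpoly) set" where
  "elementary n = {subst_hom n (\<lambda>k. if k = i then mVar i + P else mVar k) | i P.
                    i < n \<and> P \<in> Pn n \<and> i \<notin> mvars P \<and> const_coeff P = 0}"

definition GL_lin :: "nat \<Rightarrow> ('a::comm_ring_1 mpoly \<Rightarrow> 'a mpoly) set" where
  "GL_lin n = {subst_hom n (\<lambda>i. \<Sum>j<n. mConst (A i j) * mVar j) | A.
                 \<exists>B. (\<forall>i<n. \<forall>k<n. (\<Sum>j<n. A i j * B j k) = (if i = k then 1 else 0))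
                   \<and> (\<forall>i<n. \<forall>k<n. (\<Sum>j<n. B i j * A j k) = (if i = k then 1 else 0))}"

definition alg_closed_field :: "'a::field itself \<Rightarrow> bool" where
  "alg_closed_field _ \<longleftrightarrow> (\<forall>q :: 'a poly. degree q \<ge> 1 \<longrightarrow> (\<exists>x. poly q x = 0))"

end

theory Submission
  imports Defs
begin

text \<open>
  Write \<open>e(i, P)\<close> for \<open>x\<^sub>i \<mapsto> x\<^sub>i + P\<close>. For a monomial \<open>M\<close> free of \<open>x\<^sub>i\<close>, the image of \<open>e(i, c M)\<close> commutes
  with the subtorus \<open>\<lambda>\<^sup>M = \<lambda>\<^sub>i\<close>; comparing weights, it maps each \<open>x\<^sub>k\<close> to a multiple of \<open>x\<^sub>k\<close> and \<open>x\<^sub>i\<close> to a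
  combination of \<open>x\<^sub>i\<close> and \<open>M\<close> (linear \<open>M\<close> needs an extra argument). The diagonal entries are \<open>1\<close> because the torus element with
  \<open>\<lambda>\<^sub>i = 1/2\<close> conjugates \<open>e(i, c M)\<close> to its square. Hence the automorphism multiplies every monomial \<open>M\<close>
  in \<open>e(i, P)\<close> by a factor \<open>b\<^sub>i(M) \<noteq> 0\<close>. Conjugating \<open>e(j, q x\<^sub>i\<^sup>d)\<close> by \<open>e(i, m)\<close> gives
  \<open>b\<^sub>j(q m\<^sup>d) = b\<^sub>j(q x\<^sub>i\<^sup>d) b\<^sub>i(m)\<^sup>d\<close>, and with at least four variables these relations force
  \<open>b\<^sub>i(M) = s\<^sup>M / s\<^sub>i\<close> for a single torus element \<open>s\<close>, whose inverse is the required conjugator.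
\<close>

abbreviation lookup :: "('b \<Rightarrow>\<^sub>0 'c::zero) \<Rightarrow> 'b \<Rightarrow> 'c" where "lookup \<equiv> Poly_Mapping.lookup"
abbreviation keys :: "('b \<Rightarrow>\<^sub>0 'c::zero) \<Rightarrow> 'b set" where "keys \<equiv> Poly_Mapping.keys"
abbreviation single :: "'b \<Rightarrow> 'c::zero \<Rightarrow> 'b \<Rightarrow>\<^sub>0 'c" where "single \<equiv> Poly_Mapping.single"

section \<open>Substitution homomorphisms\<close>

text \<open>The value at \<open>F\<close> of the monomial with exponent vector \<open>m\<close>. The
  target type is open because it serves twice: polynomial values give substitution, field values
  give the weight of a monomial under a torus element.\<close>

definition mpow :: "('b \<Rightarrow> 'c::comm_monoid_mult) \<Rightarrow> ('b \<Rightarrow>\<^sub>0 nat) \<Rightarrow> 'c" where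
  "mpow F m = (\<Prod>i\<in>keys m. F i ^ lookup m i)"

lemma mpow_eq_prod:
  assumes "finite A" "keys m \<subseteq> A"
  shows "mpow F m = (\<Prod>i\<in>A. F i ^ lookup m i)"
  unfolding mpow_def using assms
  by (intro prod.mono_neutral_left) (auto simp: in_keys_iff)

lemma mpow_zero [simp]: "mpow F 0 = 1"
  by (simp add: mpow_def)

lemma mpow_single [simp]: "mpow F (single i d) = F i ^ d"
  by (simp add: mpow_def)

lemma mpow_add: "mpow F (m + m') = mpow F m * mpow F m'"
proof -
  let ?A = "keys m \<union> keys m'"
  have "mpow F (m + m') = (\<Prod>i\<in>?A. F i ^ lookup (m + m') i)"
    by (intro mpow_eq_prod) (auto simp: in_keys_iff lookup_add)
  also have "\<dots> = (\<Prod>i\<in>?A. F i ^ lookup m i) * (\<Prod>i\<in>?A. F i ^ lookup m' i)"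
    by (simp add: lookup_add power_add prod.distrib)
  also have "\<dots> = mpow F m * mpow F m'"
    by (simp add: mpow_eq_prod[of ?A m] mpow_eq_prod[of ?A m'])
  finally show ?thesis .
qed

lemma mpow_cong: "(\<And>i. i \<in> keys m \<Longrightarrow> F i = G i) \<Longrightarrow> mpow F m = mpow G m"
  by (simp add: mpow_def)

lemma mpow_mult: "mpow (\<lambda>i. F i * G i) m = mpow F m * mpow G m"
  by (simp add: mpow_def power_mult_distrib prod.distrib)

lemma mpow_one [simp]: "mpow (\<lambda>_. 1) m = 1"
  by (simp add: mpow_def)

lemma mpow_nonzero:
  fixes F :: "'b \<Rightarrow> 'c::field"
  shows "(\<And>i. i \<in> keys m \<Longrightarrow> F i \<noteq> 0) \<Longrightarrow> mpow F m \<noteq> 0"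
  by (simp add: mpow_def)

lemma poly_mapping_induct_keys [consumes 1, case_names zero add]:
  fixes p :: "'b \<Rightarrow>\<^sub>0 'c::comm_monoid_add"
  assumes "keys p \<subseteq> A"
    and "P 0"
    and "\<And>m c p. m \<in> A \<Longrightarrow> keys p \<subseteq> A \<Longrightarrow> P p \<Longrightarrow> P (single m c + p)"
  shows "P p"
proof -
  have decomp: "p = (\<Sum>m\<in>keys p. single m (lookup p m))"
    by (rule poly_mapping_eqI) (auto simp: lookup_sum lookup_single when_def in_keys_iff)
  have "keys (\<Sum>m\<in>B. single m (lookup p m)) \<subseteq> A \<and> P (\<Sum>m\<in>B. single m (lookup p m))"
    if "finite B" "B \<subseteq> keys p" for B
    using that
  proof (induction B rule: finite_induct)
    case empty
    then show ?case using assms(2) by simp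
  next
    case (insert m B)
    then have IH: "keys (\<Sum>m\<in>B. single m (lookup p m)) \<subseteq> A" "P (\<Sum>m\<in>B. single m (lookup p m))"
      and m: "m \<in> A" using assms(1) by auto
    have "keys (single m (lookup p m) + (\<Sum>m\<in>B. single m (lookup p m))) \<subseteq> A"
      using keys_add[of "single m (lookup p m)" "\<Sum>m\<in>B. single m (lookup p m)"] IH(1) m
      by (auto split: if_splits)
    with assms(3)[OF m IH] insert show ?case by simp
  qed
  from this[of "keys p"] decomp show ?thesis by simp
qed

lemma poly_mapping_induct_add [case_names zero add]:
  fixes p :: "'b \<Rightarrow>\<^sub>0 'c::comm_monoid_add"
  assumes "P 0" and "\<And>m c p. P p \<Longrightarrow> P (single m c + p)"
  shows "P p"
  by (rule poly_mapping_induct_keys[of p UNIV P]) (use assms in auto)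

lemma single_eq_0_iff [simp]: "single k c = 0 \<longleftrightarrow> c = 0"
  by (metis single_zero lookup_single_eq lookup_zero)

text \<open>The exponent vector of the \<open>d\<close>-th power of the monomial
  \<open>m\<close>.\<close>

primrec mscale :: "nat \<Rightarrow> ('b \<Rightarrow>\<^sub>0 nat) \<Rightarrow> 'b \<Rightarrow>\<^sub>0 nat" where
  "mscale 0 m = 0"
| "mscale (Suc d) m = m + mscale d m"

lemma lookup_mscale: "lookup (mscale d m) i = d * lookup m i"
  by (induction d) (simp_all add: lookup_add)

lemma mscale_single: "mscale d (single i e) = single i (d * e)"
  by (rule poly_mapping_eqI) (simp add: lookup_mscale lookup_single when_def)

lemma mpow_mscale: "mpow F (mscale d m) = mpow F m ^ d"
  by (induction d) (simp_all add: mpow_add)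

lemma mConst_mult_single: "mConst c * single m d = single m (c * d)"
  by (simp add: mConst_def mult_single)

lemma lookup_mConst_mult: "lookup (mConst c * p) m = c * lookup p m"
  by (induction p rule: poly_mapping_induct_add)
     (simp_all add: ring_distribs lookup_add mConst_mult_single lookup_single when_def)

lemma mConst_mult: "mConst (c * d) = mConst c * mConst d"
  by (simp add: mConst_def mult_single)

lemma mConst_add: "mConst (c + d) = mConst c + mConst d"
  by (simp add: mConst_def single_add)

lemma mConst_1 [simp]: "mConst 1 = 1"
  by (simp add: mConst_def)

lemma mConst_0 [simp]: "mConst 0 = 0"
  by (simp add: mConst_def)

lemma const_coeff_mConst [simp]: "const_coeff (mConst c) = c"
  by (simp add: const_coeff_def mConst_def)

lemma const_coeff_mVar [simp]: "const_coeff (mVar i) = 0"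
  by (simp add: const_coeff_def mVar_def lookup_single when_def)

lemma const_coeff_add: "const_coeff (p + q) = const_coeff p + const_coeff q"
  by (simp add: const_coeff_def lookup_add)

lemma single_power: "(single m c :: 'a::comm_ring_1 mpoly) ^ d = single (mscale d m) (c ^ d)"
  by (induction d) (simp_all add: mult_single)

text \<open>\<open>subst_hom\<close> without its test for \<open>Pn n\<close>: the homomorphism laws
  then hold for all polynomials, free of side conditions.\<close>

definition sub :: "(nat \<Rightarrow> 'a::comm_ring_1 mpoly) \<Rightarrow> 'a mpoly \<Rightarrow> 'a mpoly" where
  "sub F p = (\<Sum>m\<in>keys p. mConst (lookup p m) * mpow F m)"

lemma subst_hom_eq_sub: "p \<in> Pn n \<Longrightarrow> subst_hom n F p = sub F p"
  by (simp add: subst_hom_def sub_def mpow_def)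

lemma subst_hom_outside: "p \<notin> Pn n \<Longrightarrow> subst_hom n F p = p"
  by (simp add: subst_hom_def)

lemma sub_eq_sum:
  assumes "finite A" "keys p \<subseteq> A"
  shows "sub F p = (\<Sum>m\<in>A. mConst (lookup p m) * mpow F m)"
  unfolding sub_def using assms
  by (intro sum.mono_neutral_left) (auto simp: in_keys_iff)

lemma sub_zero [simp]: "sub F 0 = 0"
  by (simp add: sub_def)

lemma sub_single: "sub F (single m c) = mConst c * mpow F m"
  by (subst sub_eq_sum[of "{m}"]) auto

lemma sub_add: "sub F (p + q) = sub F p + sub F q"
proof -
  let ?A = "keys p \<union> keys q"
  have "sub F (p + q) = (\<Sum>m\<in>?A. mConst (lookup (p + q) m) * mpow F m)"
    using keys_add[of p q] by (intro sub_eq_sum) auto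
  also have "\<dots> = sub F p + sub F q"
    by (simp add: sub_eq_sum[of ?A p] sub_eq_sum[of ?A q] lookup_add mConst_add ring_distribs sum.distrib)
  finally show ?thesis .
qed

lemma sub_mult: "sub F (p * q) = sub F p * sub F q"
proof (induction p rule: poly_mapping_induct_add)
  case (add m c p)
  have "sub F (single m c * q) = sub F (single m c) * sub F q"
    by (induction q rule: poly_mapping_induct_add)
       (simp_all add: ring_distribs sub_add mult_single sub_single mpow_add mConst_mult ac_simps)
  with add show ?case by (simp add: ring_distribs sub_add)
qed simp

lemma sub_mVar [simp]: "sub F (mVar i) = F i"
  by (simp add: mVar_def sub_single)

lemma sub_mConst [simp]: "sub F (mConst c) = mConst c"
  using sub_single[of F 0 c] by (simp add: mConst_def)

lemma sub_1 [simp]: "sub F 1 = 1"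
  using sub_mConst[of F 1] by simp

lemma sub_power: "sub F (p ^ d) = sub F p ^ d"
  by (induction d) (simp_all add: sub_mult)

lemma sub_prod: "sub F (\<Prod>i\<in>A. f i) = (\<Prod>i\<in>A. sub F (f i))"
  by (induction A rule: infinite_finite_induct) (simp_all add: sub_mult)

lemma sub_mpow: "sub F (mpow G m) = mpow (\<lambda>i. sub F (G i)) m"
  by (simp add: mpow_def sub_prod sub_power)

lemma sub_sub: "sub F (sub G p) = sub (\<lambda>i. sub F (G i)) p"
  by (induction p rule: poly_mapping_induct_add)
     (simp_all add: sub_add sub_single sub_mult sub_mpow)

lemma sub_cong: "(\<And>i. i \<in> mvars p \<Longrightarrow> F i = G i) \<Longrightarrow> sub F p = sub G p"
  unfolding sub_def by (intro sum.cong refl arg_cong2[where f="(*)"] mpow_cong) (auto simp: mvars_def)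

lemma single_eq_mpow: "single m c = mConst c * mpow mVar m"
proof -
  have "mpow mVar m = (\<Prod>i\<in>keys m. single (single i (lookup m i)) 1 :: 'a mpoly)"
    unfolding mpow_def mVar_def single_power
    by (intro prod.cong refl) (simp add: mscale_single)
  also have "\<dots> = single (\<Sum>i\<in>keys m. single i (lookup m i)) 1"
  proof -
    have "(\<Prod>i\<in>B. single (f i) 1 :: 'a mpoly) = single (\<Sum>i\<in>B. f i) 1" for B and f :: "nat \<Rightarrow> nat \<Rightarrow>\<^sub>0 nat"
      by (induction B rule: infinite_finite_induct) (simp_all add: mult_single)
    then show ?thesis .
  qed
  also have "(\<Sum>i\<in>keys m. single i (lookup m i)) = m"
    by (rule poly_mapping_eqI) (auto simp: lookup_sum lookup_single when_def in_keys_iff)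
  finally show ?thesis by (simp add: mConst_mult_single)
qed

lemma sub_mVar_id: "sub mVar p = p"
  by (induction p rule: poly_mapping_induct_add) (simp_all add: sub_add sub_single flip: single_eq_mpow)

lemma sub_ident: "(\<And>i. i \<in> mvars p \<Longrightarrow> F i = mVar i) \<Longrightarrow> sub F p = p"
  using sub_cong[of p F mVar] by (simp add: sub_mVar_id)

text \<open>Evaluation at the origin written as a substitution, so that claims about constant
  coefficients become claims about composed substitutions.\<close>

lemma sub_zero_fun: "sub (\<lambda>_. 0) p = mConst (const_coeff p)"
proof (induction p rule: poly_mapping_induct_add)
  case (add m c p)
  have "mpow (\<lambda>_. 0::'a mpoly) m = (if m = 0 then 1 else 0)"
  proof (cases "m = 0")
    case False
    then obtain i where "lookup m i \<noteq> 0" by (auto simp: poly_mapping_eq_iff fun_eq_iff)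
    then have "(0::'a mpoly) ^ lookup m i = 0" "i \<in> keys m" by (simp_all add: in_keys_iff zero_power)
    then have "(\<Prod>i\<in>keys m. (0::'a mpoly) ^ lookup m i) = 0" by (intro prod_zero) auto
    with False show ?thesis by (simp add: mpow_def)
  qed simp
  with add show ?case
    by (simp add: sub_add sub_single const_coeff_def lookup_add lookup_single when_def mConst_add)
qed (simp add: const_coeff_def)

section \<open>The polynomial ring in the first \<open>n\<close> variables\<close>

lemma mem_Pn_iff: "p \<in> Pn n \<longleftrightarrow> (\<forall>m\<in>keys p. keys m \<subseteq> {..<n})"
  by (auto simp: Pn_def mvars_def)

lemma mvars_add: "mvars (p + q) \<subseteq> mvars p \<union> mvars q"
  using keys_add[of p q] by (auto simp: mvars_def)

lemma mvars_mult: "mvars (p * q) \<subseteq> mvars p \<union> mvars q"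
proof
  fix x assume "x \<in> mvars (p * q)"
  then obtain a b where "a \<in> keys p" "b \<in> keys q" "x \<in> keys (a + b)"
    using keys_mult[of p q] by (auto simp: mvars_def)
  then show "x \<in> mvars p \<union> mvars q"
    using keys_add[of a b] by (auto simp: mvars_def)
qed

lemma mvars_single: "mvars (single m c) \<subseteq> keys m"
  by (auto simp: mvars_def split: if_splits)

lemma mvars_single_nonzero: "c \<noteq> 0 \<Longrightarrow> mvars (single m c) = keys m"
  by (auto simp: mvars_def)

lemma mvars_mVar [simp]: "mvars (mVar i :: 'a::comm_ring_1 mpoly) = {i}"
  by (simp add: mVar_def mvars_single_nonzero)

lemma mvars_mConst [simp]: "mvars (mConst c) = {}"
  by (simp add: mConst_def mvars_def)

lemma mvars_power: "mvars (p ^ d) \<subseteq> mvars p"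
  using mvars_mConst[of "1::'a"] by (induction d) (use mvars_mult in fastforce)+

lemma mvars_prod: "mvars (\<Prod>i\<in>A. f i) \<subseteq> (\<Union>i\<in>A. mvars (f i))"
  using mvars_mConst[of "1::'a"]
  by (induction A rule: infinite_finite_induct) (use mvars_mult in fastforce)+

lemma mvars_sum: "mvars (\<Sum>i\<in>A. f i) \<subseteq> (\<Union>i\<in>A. mvars (f i))"
  using mvars_mConst[of "0::'a"]
  by (induction A rule: infinite_finite_induct) (use mvars_add in fastforce)+

lemma mvars_sub: "mvars (sub F p) \<subseteq> (\<Union>i\<in>mvars p. mvars (F i))"
proof -
  have "mvars (mpow F m) \<subseteq> (\<Union>i\<in>mvars p. mvars (F i))" if "m \<in> keys p" for m
  proof -
    have "mvars (mpow F m) \<subseteq> (\<Union>i\<in>keys m. mvars (F i ^ lookup m i))"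
      unfolding mpow_def by (rule mvars_prod)
    also have "\<dots> \<subseteq> (\<Union>i\<in>keys m. mvars (F i))"
      by (intro UN_mono order_refl mvars_power)
    also have "\<dots> \<subseteq> (\<Union>i\<in>mvars p. mvars (F i))"
      using that by (auto simp: mvars_def)
    finally show ?thesis .
  qed
  then have "mvars (mConst (lookup p m) * mpow F m) \<subseteq> (\<Union>i\<in>mvars p. mvars (F i))"
    if "m \<in> keys p" for m
    using that mvars_mult[of "mConst (lookup p m)" "mpow F m"] by fastforce
  then show ?thesis
    unfolding sub_def by (intro order_trans[OF mvars_sum] UN_least)
qed

lemma Pn_add: "p \<in> Pn n \<Longrightarrow> q \<in> Pn n \<Longrightarrow> p + q \<in> Pn n"
  using mvars_add[of p q] by (auto simp: Pn_def)

lemma Pn_mult: "p \<in> Pn n \<Longrightarrow> q \<in> Pn n \<Longrightarrow> p * q \<in> Pn n"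
  using mvars_mult[of p q] by (auto simp: Pn_def)

lemma Pn_single: "keys m \<subseteq> {..<n} \<Longrightarrow> single m c \<in> Pn n"
  using mvars_single[of m c] by (auto simp: Pn_def)

lemma Pn_mVar [simp]: "i < n \<Longrightarrow> mVar i \<in> Pn n"
  by (simp add: Pn_def)

lemma Pn_mConst [simp]: "mConst c \<in> Pn n"
  by (simp add: Pn_def)

lemma Pn_0 [simp]: "0 \<in> Pn n"
  using Pn_mConst[of 0 n] by simp

lemma Pn_sum: "(\<And>i. i \<in> A \<Longrightarrow> f i \<in> Pn n) \<Longrightarrow> sum f A \<in> Pn n"
  using mvars_sum[of f A] by (fastforce simp: Pn_def)

lemma Pn_prod: "(\<And>i. i \<in> A \<Longrightarrow> f i \<in> Pn n) \<Longrightarrow> prod f A \<in> Pn n"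
  using mvars_prod[of f A] by (fastforce simp: Pn_def)

lemma Pn_power: "p \<in> Pn n \<Longrightarrow> p ^ d \<in> Pn n"
  using mvars_power[of p d] by (auto simp: Pn_def)

lemma Pn_sub:
  assumes "p \<in> Pn n" "\<And>i. i < n \<Longrightarrow> F i \<in> Pn n"
  shows "sub F p \<in> Pn n"
  using mvars_sub[of F p] assms by (fastforce simp: Pn_def)

section \<open>Endomorphisms and origin-preserving automorphisms\<close>

lemma alg_endo_subst_hom:
  assumes "\<And>i. i < n \<Longrightarrow> F i \<in> Pn n"
  shows "alg_endo n (subst_hom n F)"
  unfolding alg_endo_def using assms
  by (auto simp: subst_hom_eq_sub subst_hom_outside Pn_add Pn_mult Pn_sub sub_add sub_mult)

lemma alg_endo_1: "alg_endo n h \<Longrightarrow> h 1 = 1"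
  by (metis alg_endo_def mConst_1)

lemma alg_endo_power: "alg_endo n h \<Longrightarrow> p \<in> Pn n \<Longrightarrow> h (p ^ d) = h p ^ d"
  by (induction d) (simp_all add: alg_endo_1, simp add: alg_endo_def Pn_power)

lemma alg_endo_prod:
  "alg_endo n h \<Longrightarrow> (\<And>i. i \<in> A \<Longrightarrow> f i \<in> Pn n) \<Longrightarrow> h (prod f A) = (\<Prod>i\<in>A. h (f i))"
  by (induction A rule: infinite_finite_induct)
     (auto simp: alg_endo_1 Pn_prod alg_endo_def)

text \<open>Expanding \<open>p\<close> into terms, the algebra laws determine \<open>h\<close> from
  the images of the variables.\<close>

lemma alg_endo_eq_sub:
  assumes h: "alg_endo n h" and p: "p \<in> Pn n"
  shows "h p = sub (\<lambda>i. h (mVar i)) p"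
proof -
  from p have "keys p \<subseteq> {m. keys m \<subseteq> {..<n}}" by (auto simp: mem_Pn_iff)
  then show ?thesis
  proof (induction p rule: poly_mapping_induct_keys)
    case zero
    have "h (mConst 0) = mConst 0" using h unfolding alg_endo_def by blast
    then show ?case by simp
  next
    case (add m c p)
    then have m: "keys m \<subseteq> {..<n}" and p: "p \<in> Pn n" by (auto simp: mem_Pn_iff)
    have mp: "(mpow mVar m :: 'a mpoly) \<in> Pn n"
      unfolding mpow_def using m by (intro Pn_prod Pn_power) auto
    have "h (mpow mVar m) = mpow (\<lambda>i. h (mVar i)) m"
      unfolding mpow_def using m
      by (subst alg_endo_prod[OF h]) (auto intro!: Pn_power prod.cong simp: alg_endo_power[OF h] subset_iff)
    moreover have "h (mConst c * mpow mVar m) = mConst c * h (mpow mVar m)"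
      using h mp unfolding alg_endo_def by (metis Pn_mConst)
    ultimately have "h (single m c) = sub (\<lambda>i. h (mVar i)) (single m c)"
      by (simp add: single_eq_mpow[of m c] sub_single sub_mult sub_mpow)
    moreover have "h (single m c + p) = h (single m c) + h p"
      using h p Pn_single[OF m] unfolding alg_endo_def by blast
    ultimately show ?case using add by (simp add: sub_add)
  qed
qed

text \<open>Inside \<open>Pn n\<close> both maps are substitutions, outside it both are the identity
  by convention; so equality need only be tested on variables.\<close>

lemma alg_endo_eqI:
  assumes "alg_endo n g" "alg_endo n h" "\<And>i. i < n \<Longrightarrow> g (mVar i) = h (mVar i)"
  shows "g = h"
proof
  fix p
  show "g p = h p"
  proof (cases "p \<in> Pn n")
    case True
    then show ?thesis
      unfolding alg_endo_eq_sub[OF assms(1) True] alg_endo_eq_sub[OF assms(2) True]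
      by (intro sub_cong assms(3)) (auto simp: Pn_def)
  next
    case False
    then show ?thesis using assms by (simp add: alg_endo_def)
  qed
qed

lemma alg_endo_id: "alg_endo n id"
  by (simp add: alg_endo_def)

lemma alg_endo_comp: "alg_endo n g \<Longrightarrow> alg_endo n h \<Longrightarrow> alg_endo n (g \<circ> h)"
  unfolding alg_endo_def by (auto simp: image_subset_iff)

lemma Aut0_imp_alg_endo: "h \<in> Aut0 n \<Longrightarrow> alg_endo n h"
  by (simp add: Aut0_def)

text \<open>Evaluation at the origin after \<open>h\<close> sends each variable to the constant
  coefficient of its image, which is \<open>0\<close>; so it is again evaluation at the
  origin.\<close>

lemma alg_endo_const_coeff:
  assumes "alg_endo n h" "\<And>i. i < n \<Longrightarrow> const_coeff (h (mVar i)) = 0" "p \<in> Pn n"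
  shows "const_coeff (h p) = const_coeff p"
proof -
  have "mConst (const_coeff (h p)) = sub (\<lambda>_. 0) (sub (\<lambda>i. h (mVar i)) p)"
    unfolding sub_zero_fun alg_endo_eq_sub[OF assms(1,3), symmetric] ..
  also have "\<dots> = sub (\<lambda>_. 0) p"
    unfolding sub_sub using assms by (intro sub_cong) (auto simp: sub_zero_fun Pn_def)
  finally show ?thesis by (metis const_coeff_mConst sub_zero_fun)
qed

lemma id_mem_Aut0: "id \<in> Aut0 n"
  by (simp add: Aut0_def alg_endo_id)

lemma Aut0_comp:
  assumes "g \<in> Aut0 n" "h \<in> Aut0 n"
  shows "g \<circ> h \<in> Aut0 n"
proof -
  have "h (mVar i) \<in> Pn n" if "i < n" for i
    using assms that by (auto simp: Aut0_def alg_endo_def image_subset_iff)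
  then show ?thesis
    using assms by (auto simp: Aut0_def alg_endo_comp alg_endo_const_coeff intro: bij_betw_trans)
qed

lemma monoid_Aut0_group: "monoid (Aut0_group n)"
  by unfold_locales (auto simp: Aut0_group_def id_mem_Aut0 Aut0_comp comp_assoc)

lemma Aut0I:
  assumes "alg_endo n g" "alg_endo n h" "g \<circ> h = id" "h \<circ> g = id"
    and "\<And>i. i < n \<Longrightarrow> const_coeff (g (mVar i)) = 0"
  shows "g \<in> Aut0 n"
proof -
  have "bij_betw g (Pn n) (Pn n)"
    by (rule bij_betw_byWitness[where f'=h])
       (use assms in \<open>auto simp: alg_endo_def fun_eq_iff\<close>)
  with assms show ?thesis by (simp add: Aut0_def)
qed

section \<open>Torus elements and elementary automorphisms\<close>

definition elem :: "nat \<Rightarrow> nat \<Rightarrow> 'a::comm_ring_1 mpoly \<Rightarrow> 'a mpoly \<Rightarrow> 'a mpoly" where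
  "elem n i P = subst_hom n (\<lambda>k. if k = i then mVar i + P else mVar k)"

definition admissible :: "nat \<Rightarrow> nat \<Rightarrow> 'a::comm_ring_1 mpoly set" where
  "admissible n i = {P. P \<in> Pn n \<and> i \<notin> mvars P \<and> const_coeff P = 0}"

lemma elementary_eq: "elementary n = {elem n i P | i P. i < n \<and> P \<in> admissible n i}"
  by (simp add: elementary_def elem_def admissible_def)

lemma admissible_iff:
  "P \<in> admissible n i \<longleftrightarrow> (\<forall>m\<in>keys P. keys m \<subseteq> {..<n} - {i} \<and> m \<noteq> 0)"
proof -
  have "const_coeff P = 0 \<longleftrightarrow> 0 \<notin> keys P" by (simp add: const_coeff_def in_keys_iff)
  then show ?thesis unfolding admissible_def mem_Pn_iff mvars_def by auto
qed

lemma admissible_single: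
  "keys m \<subseteq> {..<n} - {i} \<Longrightarrow> m \<noteq> 0 \<Longrightarrow> single m c \<in> admissible n i"
  by (simp add: admissible_iff)

lemma alg_endo_elem: "i < n \<Longrightarrow> P \<in> Pn n \<Longrightarrow> alg_endo n (elem n i P)"
  unfolding elem_def by (rule alg_endo_subst_hom) (simp add: Pn_add)

lemma elem_mVar: "k < n \<Longrightarrow> elem n i P (mVar k) = (if k = i then mVar i + P else mVar k)"
  by (simp add: elem_def subst_hom_eq_sub)

lemma elem_eq_sub:
  "p \<in> Pn n \<Longrightarrow> elem n i P p = sub (\<lambda>k. if k = i then mVar i + P else mVar k) p"
  by (simp add: elem_def subst_hom_eq_sub)

lemma elem_ident: "p \<in> Pn n \<Longrightarrow> i \<notin> mvars p \<Longrightarrow> elem n i P p = p"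
  by (simp add: elem_eq_sub) (rule sub_ident, auto)

lemma alg_endo_add: "alg_endo n h \<Longrightarrow> p \<in> Pn n \<Longrightarrow> q \<in> Pn n \<Longrightarrow> h (p + q) = h p + h q"
  by (simp add: alg_endo_def)

lemma alg_endo_mult: "alg_endo n h \<Longrightarrow> p \<in> Pn n \<Longrightarrow> q \<in> Pn n \<Longrightarrow> h (p * q) = h p * h q"
  by (simp add: alg_endo_def)

lemma alg_endo_mConst: "alg_endo n h \<Longrightarrow> h (mConst c) = mConst c"
  by (simp add: alg_endo_def)

lemma alg_endo_mem_Pn: "alg_endo n h \<Longrightarrow> p \<in> Pn n \<Longrightarrow> h p \<in> Pn n"
  by (auto simp: alg_endo_def)

lemma elem_comp:
  assumes "i < n" "P \<in> admissible n i" "Q \<in> admissible n i"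
  shows "elem n i P \<circ> elem n i Q = elem n i (P + Q)"
proof (rule alg_endo_eqI)
  have PQ: "P \<in> Pn n" "Q \<in> Pn n" "i \<notin> mvars Q" using assms by (auto simp: admissible_def)
  show "alg_endo n (elem n i P \<circ> elem n i Q)" "alg_endo n (elem n i (P + Q))"
    using assms(1) PQ by (auto intro: alg_endo_comp alg_endo_elem Pn_add)
  show "(elem n i P \<circ> elem n i Q) (mVar k) = elem n i (P + Q) (mVar k)" if "k < n" for k
    using that assms(1) PQ
    by (simp add: elem_mVar alg_endo_add[OF alg_endo_elem] elem_ident add_ac)
qed

lemma elem_zero: "i < n \<Longrightarrow> elem n i 0 = id"
  by (rule alg_endo_eqI[of n]) (simp_all add: alg_endo_elem alg_endo_id elem_mVar)

lemma elem_mem_Aut0: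
  assumes "i < n" "P \<in> admissible n i"
  shows "elem n i P \<in> Aut0 n"
proof (rule Aut0I)
  have P: "P \<in> Pn n" "- P \<in> Pn n" and mP: "- P \<in> admissible n i" "const_coeff P = 0"
    using assms(2) by (auto simp: admissible_def Pn_def mvars_def const_coeff_def in_keys_iff)
  show "alg_endo n (elem n i P)" "alg_endo n (elem n i (- P))"
    using assms P by (auto intro: alg_endo_elem)
  show "elem n i P \<circ> elem n i (- P) = id" "elem n i (- P) \<circ> elem n i P = id"
    using assms mP by (simp_all add: elem_comp elem_zero)
  show "const_coeff (elem n i P (mVar k)) = 0" if "k < n" for k
    using that mP by (simp add: elem_mVar const_coeff_add)
qed

text \<open>Conjugation by \<open>e(i, P)\<close> turns \<open>e(j, Q)\<close> into
  \<open>e(j, Q')\<close> with \<open>Q' = e(i, P)(Q)\<close>; as \<open>P\<close> is free of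
  \<open>x_j\<close>, the map \<open>e(j, Q')\<close> leaves \<open>x_i + P\<close> alone. This is
  the source of the relations between different directions.\<close>

lemma elem_elem:
  assumes "i < n" "j < n" "i \<noteq> j" "P \<in> Pn n" "j \<notin> mvars P" "Q \<in> Pn n"
  shows "elem n i P \<circ> elem n j Q = elem n j (elem n i P Q) \<circ> elem n i P"
proof (rule alg_endo_eqI)
  have e: "elem n i P Q \<in> Pn n" using assms by (simp add: alg_endo_mem_Pn[OF alg_endo_elem])
  show "alg_endo n (elem n i P \<circ> elem n j Q)" "alg_endo n (elem n j (elem n i P Q) \<circ> elem n i P)"
    using assms e by (auto intro: alg_endo_comp alg_endo_elem)
  show "(elem n i P \<circ> elem n j Q) (mVar k) = (elem n j (elem n i P Q) \<circ> elem n i P) (mVar k)"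
    if "k < n" for k
  proof -
    have "elem n j (elem n i P Q) (mVar i + P) = mVar i + P"
      using assms e by (simp add: alg_endo_add[OF alg_endo_elem] elem_mVar elem_ident)
    moreover have "elem n i P (mVar j + Q) = mVar j + elem n i P Q"
      using assms e by (simp add: alg_endo_add[OF alg_endo_elem] elem_mVar)
    ultimately show ?thesis using that assms(1-3) by (simp add: elem_mVar)
  qed
qed

section \<open>Torus elements and their action by conjugation\<close>

lemma mConst_mVar: "mConst c * mVar i = single (single i 1) c"
  by (simp add: mVar_def mConst_mult_single)

lemma alg_endo_torus_elt: "alg_endo n (torus_elt n lam)"
  unfolding torus_elt_def by (rule alg_endo_subst_hom) (simp add: Pn_mult)

lemma torus_elt_mVar: "k < n \<Longrightarrow> torus_elt n lam (mVar k) = mConst (lam k) * mVar k"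
  by (simp add: torus_elt_def subst_hom_eq_sub)

lemma torus_elt_single:
  assumes "keys m \<subseteq> {..<n}"
  shows "torus_elt n lam (single m c) = single m (mpow lam m * c)"
proof -
  have c: "mpow (\<lambda>i. mConst (lam i)) m = mConst (mpow lam m)"
  proof -
    have "mConst (lam i) ^ d = mConst (lam i ^ d)" for i d
      by (induction d) (simp_all add: mConst_mult)
    moreover have "(\<Prod>i\<in>A. mConst (f i)) = mConst (\<Prod>i\<in>A. f i :: 'a)" for A and f :: "nat \<Rightarrow> 'a"
      by (induction A rule: infinite_finite_induct) (simp_all add: mConst_mult)
    ultimately show ?thesis by (simp add: mpow_def)
  qed
  show ?thesis using Pn_single[OF assms, of c]
    by (simp add: torus_elt_def subst_hom_eq_sub sub_single mpow_mult c)
       (simp add: single_eq_mpow[of m] mConst_mult mult.assoc mult.left_commute)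
qed

lemma lookup_torus_elt:
  assumes "p \<in> Pn n"
  shows "lookup (torus_elt n lam p) m = mpow lam m * lookup p m"
proof -
  from assms have "keys p \<subseteq> {m. keys m \<subseteq> {..<n}}" by (auto simp: mem_Pn_iff)
  then show ?thesis
  proof (induction p rule: poly_mapping_induct_keys)
    case zero
    then show ?case using alg_endo_mConst[OF alg_endo_torus_elt[of n lam], of 0] by simp
  next
    case (add k c p)
    then have "keys k \<subseteq> {..<n}" "p \<in> Pn n" by (auto simp: mem_Pn_iff)
    with add.IH show ?case
      by (simp add: alg_endo_add[OF alg_endo_torus_elt] Pn_single torus_elt_single
          lookup_add lookup_single when_def ring_distribs)
  qed
qed

lemma torus_elt_one: "torus_elt n (\<lambda>_. 1) = id"
  by (rule alg_endo_eqI[of n]) (simp_all add: alg_endo_torus_elt alg_endo_id torus_elt_mVar)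

lemma torus_elt_cong: "(\<And>i. i < n \<Longrightarrow> lam i = mu i) \<Longrightarrow> torus_elt n lam = torus_elt n mu"
  by (rule alg_endo_eqI[of n]) (simp_all add: alg_endo_torus_elt torus_elt_mVar)

lemma torus_elt_comp: "torus_elt n lam \<circ> torus_elt n mu = torus_elt n (\<lambda>i. lam i * mu i)"
  by (rule alg_endo_eqI[of n])
     (simp_all add: alg_endo_comp alg_endo_torus_elt torus_elt_mVar alg_endo_mult[OF alg_endo_torus_elt]
       alg_endo_mConst[OF alg_endo_torus_elt] mConst_mult mult_ac)

lemma torus_elt_inverse:
  fixes lam :: "nat \<Rightarrow> 'a::field"
  assumes "\<And>i. i < n \<Longrightarrow> lam i \<noteq> 0"
  shows "torus_elt n lam \<circ> torus_elt n (\<lambda>i. 1 / lam i) = id"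
    and "torus_elt n (\<lambda>i. 1 / lam i) \<circ> torus_elt n lam = id"
proof -
  have "torus_elt n (\<lambda>i. lam i * (1 / lam i)) = torus_elt n (\<lambda>_. 1)"
    by (rule torus_elt_cong) (simp add: assms)
  then show "torus_elt n lam \<circ> torus_elt n (\<lambda>i. 1 / lam i) = id"
    and "torus_elt n (\<lambda>i. 1 / lam i) \<circ> torus_elt n lam = id"
    by (simp_all only: torus_elt_comp torus_elt_one mult.commute)
qed

lemma torus_elt_mem_Aut0:
  fixes lam :: "nat \<Rightarrow> 'a::field"
  assumes "\<And>i. i < n \<Longrightarrow> lam i \<noteq> 0"
  shows "torus_elt n lam \<in> Aut0 n"
  by (rule Aut0I[OF alg_endo_torus_elt alg_endo_torus_elt torus_elt_inverse])
     (simp_all add: assms torus_elt_mVar const_coeff_def mConst_mVar lookup_single when_def)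

lemma torus_elt_mem_GL_lin:
  fixes lam :: "nat \<Rightarrow> 'a::field"
  assumes "\<And>i. i < n \<Longrightarrow> lam i \<noteq> 0"
  shows "torus_elt n lam \<in> GL_lin n"
proof -
  let ?A = "\<lambda>i j. if i = j then lam i else 0"
  let ?B = "\<lambda>i j. if i = j then 1 / lam i else 0"
  let ?h = "subst_hom n (\<lambda>i. \<Sum>j<n. mConst (?A i j) * mVar j)"
  have "torus_elt n lam = ?h"
  proof (rule alg_endo_eqI)
    show "alg_endo n (torus_elt n lam)" by (rule alg_endo_torus_elt)
    show "alg_endo n ?h" by (rule alg_endo_subst_hom) (intro Pn_sum Pn_mult, auto)
    have "(\<Sum>j<n. mConst (?A i j) * mVar j) = mConst (lam i) * mVar i" if "i < n" for i
      using that by (subst sum.mono_neutral_right[of _ "{i}"]) auto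
    then show "torus_elt n lam (mVar i) = ?h (mVar i)" if "i < n" for i
      using that by (simp add: torus_elt_mVar subst_hom_eq_sub)
  qed
  moreover have "(\<Sum>j<n. ?A i j * ?B j k) = (if i = k then 1 else 0)"
    "(\<Sum>j<n. ?B i j * ?A j k) = (if i = k then 1 else 0)" if "i < n" "k < n" for i k
    using that assms by (simp_all add: if_distrib[of "\<lambda>x. x * _"] cong: if_cong)
  ultimately show ?thesis
    unfolding GL_lin_def by (intro CollectI exI[of _ ?A] conjI exI[of _ ?B] allI impI)
qed

text \<open>The coefficient condition says that the torus element maps \<open>P\<close> to
  \<open>lam i\<close> times \<open>Q\<close>. It is used with \<open>Q = P\<close> for commutation,
  with \<open>Q = 2 P\<close> for squaring, and at the end for the conjugator.\<close>

lemma torus_elt_comp_elem: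
  assumes "i < n" "P \<in> Pn n" "Q \<in> Pn n"
    and "\<And>m. mpow lam m * lookup P m = lam i * lookup Q m"
  shows "torus_elt n lam \<circ> elem n i P = elem n i Q \<circ> torus_elt n lam"
proof (rule alg_endo_eqI)
  show "alg_endo n (torus_elt n lam \<circ> elem n i P)" "alg_endo n (elem n i Q \<circ> torus_elt n lam)"
    using assms by (auto intro: alg_endo_comp alg_endo_elem alg_endo_torus_elt)
  have "torus_elt n lam P = mConst (lam i) * Q"
    by (rule poly_mapping_eqI) (simp add: assms lookup_torus_elt lookup_mConst_mult)
  then show "(torus_elt n lam \<circ> elem n i P) (mVar k) = (elem n i Q \<circ> torus_elt n lam) (mVar k)"
    if "k < n" for k
    using that assms
    by (simp add: elem_mVar torus_elt_mVar alg_endo_add[OF alg_endo_torus_elt]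
        alg_endo_mult[OF alg_endo_elem] alg_endo_mConst[OF alg_endo_elem] ring_distribs)
qed

section \<open>Coefficients of monomials free of one variable\<close>

lemma lookup_sub_zero_var:
  assumes "i \<notin> keys m"
  shows "lookup (sub (\<lambda>k. if k = i then 0 else mVar k) p) m = lookup p m"
proof (induction p rule: poly_mapping_induct_add)
  case (add k c p)
  let ?F = "\<lambda>k. if k = i then 0 else mVar k :: 'a mpoly"
  have "lookup (sub ?F (single k c)) m = lookup (single k c) m"
  proof (cases "i \<in> keys k")
    case True
    then have "?F i ^ lookup k i = 0" by (simp add: in_keys_iff zero_power)
    then have "(\<Prod>i\<in>keys k. ?F i ^ lookup k i) = 0" using True by (intro prod_zero) auto
    then have "mpow ?F k = 0" by (simp only: mpow_def)
    moreover have "k \<noteq> m" using True assms by auto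
    ultimately show ?thesis by (simp add: sub_single lookup_single when_def)
  next
    case False
    then have "sub ?F (single k c) = single k c"
      using mvars_single[of k c] by (intro sub_ident) auto
    then show ?thesis by simp
  qed
  with add show ?case by (simp add: sub_add lookup_add)
qed simp

text \<open>In \<open>e q (x_i + c m)^d\<close> the monomial \<open>q m^d\<close> is free of
  \<open>x_i\<close>, so its coefficient can be read off after setting \<open>x_i\<close> to
  \<open>0\<close>. Only \<open>e q (c m)^d\<close> remains, and no binomial expansion is
  needed.\<close>

lemma lookup_elem_single:
  fixes c :: "'a::comm_ring_1"
  assumes "i < n" "keys q \<subseteq> {..<n} - {i}" "keys m \<subseteq> {..<n} - {i}"
  shows "lookup (elem n i (single m c) (single (q + single i d) e)) (q + mscale d m) = e * c ^ d"
proof -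
  let ?P = "single m c"
  let ?F = "\<lambda>k. if k = i then mVar i + ?P else mVar k"
  let ?Z = "\<lambda>k. if k = i then 0 else mVar k :: 'a mpoly"
  have k: "keys (q + single i d) \<subseteq> {..<n}"
    using assms keys_add[of q "single i d"] by (auto split: if_splits)
  have "i \<notin> keys (q + mscale d m)"
    using assms(2,3) by (auto simp: in_keys_iff lookup_add lookup_mscale subset_iff)
  then have "lookup (elem n i ?P (single (q + single i d) e)) (q + mscale d m)
      = lookup (sub ?Z (sub ?F (single (q + single i d) e))) (q + mscale d m)"
    by (simp add: elem_eq_sub[OF Pn_single[OF k]] lookup_sub_zero_var)
  also have "sub ?Z (sub ?F (single (q + single i d) e)) = sub (\<lambda>k. if k = i then ?P else mVar k) (single (q + single i d) e)"
  proof -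
    have "sub ?Z ?P = ?P"
      using assms mvars_single[of m c] by (intro sub_ident) auto
    then show ?thesis unfolding sub_sub
      by (intro sub_cong) (simp add: sub_add)
  qed
  also have "\<dots> = mConst e * (mpow (\<lambda>k. if k = i then ?P else mVar k) q * ?P ^ d)"
    by (simp add: sub_single mpow_add)
  also have "mpow (\<lambda>k. if k = i then ?P else mVar k) q = mpow mVar q"
    using assms by (intro mpow_cong) auto
  also have "mpow mVar q = single q 1"
    by (simp add: single_eq_mpow)
  also have "mConst e * (single q 1 * ?P ^ d) = single (q + mscale d m) (e * c ^ d)"
    by (simp add: single_power mult_single mConst_mult_single)
  finally show ?thesis by simp
qed

section \<open>Images of elementary automorphisms\<close>

text \<open>Pigeonhole on the indices \<open>0\<close> to \<open>3\<close>; the excluded indices may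
  coincide.\<close>

lemma ex_fresh_index:
  fixes n :: nat
  assumes "n > 3"
  shows "\<exists>i<n. i \<noteq> k \<and> i \<noteq> l \<and> i \<noteq> l'"
proof -
  have "\<not> {..<4} \<subseteq> {k, l, l'}"
    using card_mono[of "{k, l, l'}" "{..<4::nat}"] by (auto simp: card_insert_if split: if_splits)
  then obtain i where "i < 4" "i \<notin> {k, l, l'}" by auto
  then show ?thesis using assms by (intro exI[of _ i]) auto
qed

lemma mpow_two:
  assumes "i \<noteq> j"
  shows "mpow (\<lambda>l. if l = j then s else if l = i then u else 1) m = s ^ lookup m j * u ^ lookup m i"
proof -
  let ?A = "keys m \<union> {i, j}"
  have "mpow (\<lambda>l. if l = j then s else if l = i then u else 1) m =
      (\<Prod>l\<in>?A. (if l = j then s ^ lookup m j else 1) * (if l = i then u ^ lookup m i else 1))"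
    using assms by (subst mpow_eq_prod[of ?A]) (auto intro!: prod.cong)
  also have "\<dots> = s ^ lookup m j * u ^ lookup m i"
    by (simp add: prod.distrib)
  finally show ?thesis .
qed

lemma mpow_one_var: "mpow (\<lambda>l. if l = i then u else 1) m = u ^ lookup m i"
proof -
  let ?A = "keys m \<union> {i}"
  have "mpow (\<lambda>l. if l = i then u else 1) m = (\<Prod>l\<in>?A. (if l = i then u else 1) ^ lookup m l)"
    by (rule mpow_eq_prod) auto
  also have "\<dots> = (\<Prod>l\<in>?A. if l = i then u ^ lookup m i else 1)"
    by (rule prod.cong) auto
  finally show ?thesis by simp
qed

lemma eq_single_if_keys: "keys p \<subseteq> {m} \<Longrightarrow> p = single m (lookup p m)"
  by (rule poly_mapping_eqI) (auto simp: lookup_single when_def in_keys_iff)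

lemma eq_add_single_if_keys:
  "keys p \<subseteq> {m, m'} \<Longrightarrow> m \<noteq> m' \<Longrightarrow> p = single m (lookup p m) + single m' (lookup p m')"
  by (rule poly_mapping_eqI) (auto simp: lookup_add lookup_single when_def in_keys_iff)

lemma lookup_mult_single: "lookup (p * single m c) (k + m) = lookup (p :: 'a::comm_ring_1 mpoly) k * c"
  by (induction p rule: poly_mapping_induct_add)
     (simp_all add: ring_distribs lookup_add mult_single lookup_single when_def)

lemma alg_endo_single:
  assumes "alg_endo n h" "keys m \<subseteq> {..<n}" "\<And>k. k \<in> keys m \<Longrightarrow> h (mVar k) = mVar k"
  shows "h (single m c) = single m c"
proof -
  have "h (single m c) = sub (\<lambda>i. h (mVar i)) (single m c)"
    using alg_endo_eq_sub[OF assms(1) Pn_single[OF assms(2)]] .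
  also have "\<dots> = single m c"
    using mvars_single[of m c] assms(3) by (intro sub_ident) auto
  finally show ?thesis .
qed

lemma Aut0_inj: "h \<in> Aut0 n \<Longrightarrow> p \<in> Pn n \<Longrightarrow> q \<in> Pn n \<Longrightarrow> h p = h q \<Longrightarrow> p = q"
  by (auto simp: Aut0_def bij_betw_def inj_on_def)

lemma alg_endo_0: "alg_endo n h \<Longrightarrow> h 0 = 0"
  using alg_endo_mConst[of n h 0] by simp

lemma mVar_nonzero: "mVar i \<noteq> (0 :: 'a::comm_ring_1 mpoly)"
  by (simp add: mVar_def)

lemma lookup_mVar: "lookup (mVar i :: 'a::comm_ring_1 mpoly) m = (if m = single i 1 then 1 else 0)"
  by (auto simp: mVar_def lookup_single when_def)

text \<open>\<open>f\<close> preserves the eigenspaces of a torus element that commutes with it. As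
  \<open>x_k\<close> has eigenvalue \<open>lam k\<close>, so does every monomial occurring in its
  image.\<close>

lemma torus_commuting_weight:
  fixes lam :: "nat \<Rightarrow> 'a::field"
  assumes "alg_endo n f" "k < n" "torus_elt n lam \<circ> f = f \<circ> torus_elt n lam" "m \<in> keys (f (mVar k))"
  shows "mpow lam m = lam k"
proof -
  have fk: "f (mVar k) \<in> Pn n" using assms(1,2) by (simp add: alg_endo_mem_Pn)
  have "torus_elt n lam (f (mVar k)) = f (torus_elt n lam (mVar k))"
    using fun_cong[OF assms(3), of "mVar k"] by simp
  also have "\<dots> = mConst (lam k) * f (mVar k)"
    using assms(1,2) by (simp add: torus_elt_mVar alg_endo_mult alg_endo_mConst)
  finally have "mpow lam m * lookup (f (mVar k)) m = lam k * lookup (f (mVar k)) m"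
    using fk by (metis lookup_torus_elt lookup_mConst_mult)
  then show ?thesis using assms(4) by (simp add: in_keys_iff)
qed

text \<open>What the argument draws from the field: \<open>2\<close> is invertible, and no positive
  \<open>d\<close> satisfies \<open>t ^ d = 1\<close> for all nonzero \<open>t\<close>, so that
  exponents can be recovered from weights.\<close>

locale torus_fixing =
  fixes \<Phi> :: "('a::field mpoly \<Rightarrow> 'a mpoly) \<Rightarrow> ('a mpoly \<Rightarrow> 'a mpoly)" and n :: nat
  assumes n: "n > 3"
    and two: "(2::'a) \<noteq> 0"
    and non_torsion: "\<And>d. d > 0 \<Longrightarrow> \<exists>t::'a. t \<noteq> 0 \<and> t ^ d \<noteq> 1"
    and iso: "\<Phi> \<in> iso (Aut0_group n) (Aut0_group n)"
    and fixes_torus: "\<And>lam. (\<And>i. i < n \<Longrightarrow> lam i \<noteq> 0) \<Longrightarrow> \<Phi> (torus_elt n lam) = torus_elt n lam"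
begin

lemma \<Phi>_mem: "f \<in> Aut0 n \<Longrightarrow> \<Phi> f \<in> Aut0 n"
  using iso by (auto simp: iso_def hom_def Aut0_group_def)

lemma \<Phi>_comp: "f \<in> Aut0 n \<Longrightarrow> g \<in> Aut0 n \<Longrightarrow> \<Phi> (f \<circ> g) = \<Phi> f \<circ> \<Phi> g"
  using iso by (auto simp: iso_def hom_def Aut0_group_def)

lemma \<Phi>_inj: "f \<in> Aut0 n \<Longrightarrow> g \<in> Aut0 n \<Longrightarrow> \<Phi> f = \<Phi> g \<Longrightarrow> f = g"
  using iso by (auto simp: iso_def bij_betw_def inj_on_def Aut0_group_def)

lemma \<Phi>_id: "\<Phi> id = id"
  using fixes_torus[of "\<lambda>_. 1"] by (simp add: torus_elt_one)

lemma power_eq_imp_eq: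
  assumes "\<And>t::'a. t \<noteq> 0 \<Longrightarrow> t ^ x = t ^ y"
  shows "x = y"
proof -
  have "\<not> y < x" if *: "\<And>t::'a. t \<noteq> 0 \<Longrightarrow> t ^ x = t ^ y" for x y
  proof
    assume "y < x"
    then obtain t :: 'a where t: "t \<noteq> 0" "t ^ (x - y) \<noteq> 1" using non_torsion[of "x - y"] by auto
    have "t ^ (x - y) * t ^ y = t ^ y"
      using *[OF t(1)] \<open>y < x\<close> by (simp flip: power_add)
    with t show False by simp
  qed
  from this[of x y] this[of y x] assms show ?thesis by (metis linorder_neqE_nat)
qed

section \<open>Torus weights and the image of \<open>e(i, c M)\<close> for a single monomial\<close>

context
  fixes i :: nat and M :: "nat \<Rightarrow>\<^sub>0 nat"
  assumes i: "i < n" and M: "keys M \<subseteq> {..<n} - {i}" "M \<noteq> 0"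
begin

lemma lookup_monomial_own_var [simp]: "lookup M i = 0"
  using M by (auto simp: in_keys_iff subset_iff)

lemma elem_single_mem: "elem n i (single M (c::'a)) \<in> Aut0 n"
  using i M by (intro elem_mem_Aut0 admissible_single)

lemma single_monomial_mem_Pn: "single M (c::'a) \<in> Pn n"
  using M by (intro Pn_single) auto

text \<open>Weights under a one-parameter subtorus agree for all \<open>t\<close>, hence so do the
  exponents. On the right \<open>M\<close> stands in for \<open>x_i\<close>, because the two have
  equal weight.\<close>

lemma image_weight:
  assumes k: "k < n" and m: "m \<in> keys (\<Phi> (elem n i (single M c)) (mVar k))" and j: "j \<noteq> i"
  shows "lookup m i * lookup M j + lookup m j = lookup (if k = i then M else single k 1) j"
proof (rule power_eq_imp_eq)
  fix t :: 'a assume t: "t \<noteq> 0"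
  let ?E = "elem n i (single M c)"
  \<comment> \<open>Since \<open>M\<close> is free of \<open>x_i\<close>, these entries give
    \<open>M\<close> and \<open>x_i\<close> the same weight \<open>t ^ lookup M j\<close>. So the
    element commutes with \<open>?E\<close>, and being fixed by \<open>\<Phi>\<close> also with the
    image of \<open>?E\<close>.\<close>
  define lam where "lam = (\<lambda>l. if l = j then t else if l = i then t ^ lookup M j else 1)"
  have mp: "mpow lam m = t ^ lookup m j * (t ^ lookup M j) ^ lookup m i" for m
    unfolding lam_def using j by (simp add: mpow_two)
  have nz: "lam l \<noteq> 0" for l using t by (simp add: lam_def)
  have "torus_elt n lam \<circ> ?E = ?E \<circ> torus_elt n lam"
    using i single_monomial_mem_Pn j by (intro torus_elt_comp_elem) (auto simp: lookup_single when_def mp, simp add: lam_def)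
  then have "torus_elt n lam \<circ> \<Phi> ?E = \<Phi> ?E \<circ> torus_elt n lam"
    using \<Phi>_comp[OF torus_elt_mem_Aut0[of n lam] elem_single_mem[of c]]
      \<Phi>_comp[OF elem_single_mem[of c] torus_elt_mem_Aut0[of n lam]] fixes_torus[of lam] nz by simp
  then have "mpow lam m = lam k"
    using torus_commuting_weight[OF Aut0_imp_alg_endo[OF \<Phi>_mem[OF elem_single_mem]] k _ m] by simp
  then have "t ^ (lookup m i * lookup M j + lookup m j) = lam k"
    by (simp add: mp power_add power_mult[symmetric] mult.commute)
  then show "t ^ (lookup m i * lookup M j + lookup m j) = t ^ lookup (if k = i then M else single k 1) j"
    using j by (auto simp: lam_def lookup_single when_def)
qed

text \<open>Solves the equations of \<open>image_weight\<close> for \<open>m\<close>. If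
  \<open>x_i\<close> does not occur in \<open>m\<close>, they give \<open>m\<close> directly. If it
  occurs, an index with \<open>lookup M j > 0\<close> forces \<open>m = x_i\<close> and
  \<open>M = ?R\<close>; for \<open>k \<noteq> i\<close> this is the exceptional case
  \<open>M = x_k\<close>.\<close>

lemma image_keys:
  assumes k: "k < n"
  shows "keys (\<Phi> (elem n i (single M c)) (mVar k)) \<subseteq>
    (if k = i then {M, single i 1}
     else if M = single k 1 then {single k 1, single i 1} else {single k 1})"
proof
  fix m assume m: "m \<in> keys (\<Phi> (elem n i (single M c)) (mVar k))"
  note w = image_weight[OF k m]
  let ?R = "if k = i then M else single k 1 :: nat \<Rightarrow>\<^sub>0 nat"
  obtain j where j: "lookup M j > 0" using M(2) by (auto simp: poly_mapping_eq_iff fun_eq_iff)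
  then have ji: "j \<noteq> i" by (metis lookup_monomial_own_var less_irrefl)
  consider "lookup m i = 0" | "lookup m i > 0" by blast
  then show "m \<in> (if k = i then {M, single i 1}
     else if M = single k 1 then {single k 1, single i 1} else {single k 1})"
  proof cases
    case 1
    have "lookup m l = lookup ?R l" for l
      using w[of l] 1 by (cases "l = i") (auto simp: lookup_single when_def)
    then have "m = ?R" by (intro poly_mapping_eqI)
    then show ?thesis by auto
  next
    case 2
    have R1: "lookup ?R j \<le> lookup M j"
      using w[OF ji] j 2 by (auto simp: lookup_single when_def split: if_splits)
    have "lookup m i = 1"
    proof (rule ccontr)
      assume "lookup m i \<noteq> 1"
      with 2 have "2 * lookup M j \<le> lookup m i * lookup M j" by (intro mult_right_mono) auto
      then show False using w[OF ji] j R1 by linarith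
    qed
    then have w': "lookup M l + lookup m l = lookup ?R l" if "l \<noteq> i" for l
      using w[OF that] by simp
    have "lookup m l = 0 \<and> lookup M l = lookup ?R l" if "l \<noteq> i" for l
      using w'[OF that] w'[OF ji] j by (auto simp: lookup_single when_def split: if_splits)
    moreover have "lookup M i = lookup ?R i" by (auto simp: lookup_single when_def)
    ultimately have "lookup m l = lookup (single i 1) l" "lookup M l = lookup ?R l" for l
      using \<open>lookup m i = 1\<close> by (cases "l = i"; simp add: lookup_single when_def)+
    then have "m = single i 1" "M = ?R" by (auto intro: poly_mapping_eqI)
    then show ?thesis by (auto split: if_splits)
  qed
qed

lemma elem_double: "elem n i (single M (c::'a)) \<circ> elem n i (single M c) = elem n i (single M (2 * c))"
  using elem_comp[of i n "single M c" "single M c"] i M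
  by (simp add: admissible_single flip: single_add)

text \<open>The weights still allow \<open>f\<close> to scale the variables. Transporting the
  squaring relation of the torus element that halves \<open>x_i\<close> gives
  \<open>mu = mu * mu\<close> for each scale, and injectivity of \<open>f\<close> excludes
  \<open>mu = 0\<close>.\<close>

lemma image_eq_elem:
  assumes keys: "\<And>k. k < n \<Longrightarrow> k \<noteq> i \<Longrightarrow> keys (\<Phi> (elem n i (single M c)) (mVar k)) \<subseteq> {single k 1}"
  shows "\<exists>b. \<Phi> (elem n i (single M c)) = elem n i (single M b)"
proof -
  let ?E = "elem n i (single M c)"
  define f where "f = \<Phi> ?E"
  have fA: "f \<in> Aut0 n" unfolding f_def by (intro \<Phi>_mem elem_single_mem)
  have f: "alg_endo n f" using fA by (rule Aut0_imp_alg_endo)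
  have f_nz: "f (mVar k) \<noteq> 0" if "k < n" for k
    using Aut0_inj[OF fA, of "mVar k" 0] that alg_endo_0[OF f] mVar_nonzero[of k] by auto
  \<comment> \<open>Weight \<open>1\<close> on \<open>M\<close> and \<open>1 / 2\<close> on
    \<open>x_i\<close>: conjugation doubles the coefficient, which amounts to squaring
    \<open>?E\<close>.\<close>
  define lam :: "nat \<Rightarrow> 'a" where "lam = (\<lambda>l. if l = i then 1 / 2 else 1)"
  have nz: "lam l \<noteq> 0" for l using two by (simp add: lam_def)
  have T: "torus_elt n lam \<in> Aut0 n" using nz by (intro torus_elt_mem_Aut0)
  have "torus_elt n lam \<circ> ?E = elem n i (single M (2 * c)) \<circ> torus_elt n lam"
    using i single_monomial_mem_Pn two
    by (intro torus_elt_comp_elem) (auto simp: lookup_single when_def lam_def mpow_one_var)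
  then have "torus_elt n lam \<circ> ?E = ?E \<circ> ?E \<circ> torus_elt n lam"
    by (simp add: elem_double)
  then have conj: "torus_elt n lam \<circ> f = f \<circ> f \<circ> torus_elt n lam"
    using \<Phi>_comp[OF T elem_single_mem[of c]] \<Phi>_comp[OF Aut0_comp[OF elem_single_mem elem_single_mem] T, of c c]
      \<Phi>_comp[OF elem_single_mem elem_single_mem, of c c] fixes_torus[of lam] nz
    by (simp add: f_def)
  have eval: "torus_elt n lam (f (mVar k)) = mConst (lam k) * f (f (mVar k))" if "k < n" for k
    using fun_cong[OF conj, of "mVar k"] that f
    by (simp add: torus_elt_mVar alg_endo_mult[OF f] alg_endo_mConst[OF f] alg_endo_mem_Pn[OF f])
  define mu where "mu k = lookup (f (mVar k)) (single k 1)" for k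
  have fk: "f (mVar k) = mVar k" if k: "k < n" "k \<noteq> i" for k
  proof -
    have fk: "f (mVar k) = mConst (mu k) * mVar k"
      using eq_single_if_keys[OF keys[OF k]] by (simp add: f_def mu_def mConst_mVar)
    have "mu k \<noteq> 0" using f_nz[OF k(1)] fk by auto
    have "f (f (mVar k)) = mConst (mu k) * (mConst (mu k) * mVar k)"
      by (subst fk) (use k f fk in \<open>simp add: alg_endo_mult[OF f] alg_endo_mConst[OF f]\<close>)
    moreover have "torus_elt n lam (f (mVar k)) = mConst (mu k) * mVar k"
      using k by (simp add: fk alg_endo_mult[OF alg_endo_torus_elt] alg_endo_mConst[OF alg_endo_torus_elt]
          torus_elt_mVar lam_def)
    ultimately have "mConst (mu k) * mVar k = mConst (mu k) * (mConst (mu k) * mVar k)"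
      using eval[OF k(1)] k by (simp add: lam_def)
    then have "lookup (mConst (mu k) * mVar k) (single k 1)
        = lookup (mConst (mu k) * (mConst (mu k) * mVar k)) (single k 1)" by (rule arg_cong)
    then have "mu k = mu k * mu k" by (simp add: lookup_mConst_mult lookup_mVar)
    with \<open>mu k \<noteq> 0\<close> have "mu k = 1" by simp
    with fk show ?thesis by simp
  qed
  define b where "b = lookup (f (mVar i)) M"
  have Mi: "M \<noteq> single i 1" using lookup_monomial_own_var by (metis lookup_single_eq zero_neq_one)
  have fi: "f (mVar i) = single M b + mConst (mu i) * mVar i"
    using eq_add_single_if_keys[of "f (mVar i)" M "single i 1"] image_keys[OF i, of c] Mi
    by (simp add: f_def b_def mu_def mConst_mVar)
  have fM: "f (single M b) = single M b" for b
    using M fk by (intro alg_endo_single[OF f]) auto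
  \<comment> \<open>Otherwise \<open>x_i\<close> and a multiple of \<open>M\<close> would have the
    same image, since \<open>f\<close> fixes the multiples of \<open>M\<close>.\<close>
  have "mu i \<noteq> 0"
  proof
    assume "mu i = 0"
    then have "f (mVar i) = f (single M b)" using fi fM by simp
    from Aut0_inj[OF fA _ _ this] have "mVar i = single M b" using i single_monomial_mem_Pn by simp
    then have "lookup (mVar i) (single i 1) = lookup (single M b) (single i 1)" by simp
    then show False using Mi by (simp add: lookup_mVar lookup_single when_def)
  qed
  have "f (f (mVar i)) = f (single M b) + f (mConst (mu i) * mVar i)"
    by (subst fi) (use i single_monomial_mem_Pn in \<open>simp add: alg_endo_add[OF f] Pn_mult\<close>)
  also have "f (mConst (mu i) * mVar i) = mConst (mu i) * (single M b + mConst (mu i) * mVar i)"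
    using i fi by (simp add: alg_endo_mult[OF f] alg_endo_mConst[OF f])
  finally have "lookup (f (f (mVar i))) (single i 1) = mu i * mu i"
    using Mi by (simp add: fM lookup_add lookup_mConst_mult lookup_single when_def lookup_mVar)
  moreover have "lookup (torus_elt n lam (f (mVar i))) (single i 1) = mu i / 2"
    using i alg_endo_mem_Pn[OF f, of "mVar i"] by (simp add: lookup_torus_elt lam_def mu_def)
  moreover have "lookup (torus_elt n lam (f (mVar i))) (single i 1)
      = 1 / 2 * lookup (f (f (mVar i))) (single i 1)"
    using eval[OF i] by (simp add: lookup_mConst_mult lam_def)
  ultimately have "mu i = 1" using two \<open>mu i \<noteq> 0\<close> by simp
  with fi have fi: "f (mVar i) = mVar i + single M b" by (simp add: add.commute)
  have "f = elem n i (single M b)"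
    by (rule alg_endo_eqI[OF f alg_endo_elem[OF i single_monomial_mem_Pn]]) (use fi fk in \<open>auto simp: elem_mVar\<close>)
  then show ?thesis unfolding f_def by blast
qed

lemma elem_single_eq_id: "elem n i (single M (c::'a)) = id \<Longrightarrow> c = 0"
  using elem_mVar[OF i, of i "single M c"] by simp

text \<open>For nonlinear \<open>M\<close> the exceptional case of \<open>image_keys\<close> cannot
  occur. Such images are settled first because the linear case needs one of them as a commuting
  partner.\<close>

lemma image_eq_elem_nonlinear:
  assumes "\<And>k. M \<noteq> single k 1" "c \<noteq> 0"
  shows "\<exists>b. b \<noteq> 0 \<and> \<Phi> (elem n i (single M c)) = elem n i (single M b)"
proof -
  obtain b where b: "\<Phi> (elem n i (single M c)) = elem n i (single M b)"
    using image_eq_elem[of c] image_keys[of _ c] assms(1) by presburger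
  have "b \<noteq> 0"
  proof
    assume "b = 0"
    then have "\<Phi> (elem n i (single M c)) = \<Phi> id" using b i by (simp add: elem_zero \<Phi>_id)
    then have "elem n i (single M c) = id" by (rule \<Phi>_inj[OF elem_single_mem id_mem_Aut0])
    then show False using elem_single_eq_id assms(2) by simp
  qed
  with b show ?thesis by blast
qed

end

text \<open>For \<open>M = x\<^sub>k\<close> the torus weights alone do not exclude a term \<open>x\<^sub>i\<close> in the image of \<open>x\<^sub>k\<close>;
  commuting with \<open>x\<^sub>j \<mapsto> x\<^sub>j + x\<^sub>k x\<^sub>l\<close> does, and this is where a fourth variable is needed.\<close>

lemma image_linear_keys:
  assumes i: "i < n" and k: "k < n" "k \<noteq> i"
  shows "keys (\<Phi> (elem n i (single (single k 1) c)) (mVar k)) \<subseteq> {single k 1}"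
proof -
  obtain j where j: "j < n" "j \<noteq> i" "j \<noteq> k" using ex_fresh_index[OF n] by blast
  obtain l where l: "l < n" "l \<noteq> i" "l \<noteq> k" "l \<noteq> j" using ex_fresh_index[OF n] by blast
  let ?M = "single k 1 :: nat \<Rightarrow>\<^sub>0 nat"
  let ?N = "single k 1 + single l 1 :: nat \<Rightarrow>\<^sub>0 nat"
  let ?E = "elem n i (single ?M c)" and ?G = "elem n j (single ?N (1::'a))"
  have M: "keys ?M \<subseteq> {..<n} - {i}" "?M \<noteq> 0" using k by auto
  have Nkeys: "keys ?N \<subseteq> {k, l}" using keys_add[of ?M "single l 1"] by auto
  have N: "keys ?N \<subseteq> {..<n} - {j}" using Nkeys k l j by auto
  have Nk: "lookup ?N k = 1" "lookup ?N l = 1" using l by (auto simp: lookup_add lookup_single)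
  have N0: "?N \<noteq> 0" using Nk(1) by (metis lookup_zero zero_neq_one)
  have Nlin: "?N \<noteq> single h 1" for h
    using Nk l(3) by (metis lookup_single_not_eq zero_neq_one)
  obtain b where b: "b \<noteq> 0" "\<Phi> ?G = elem n j (single ?N b)"
    using image_eq_elem_nonlinear[OF j(1) N N0 Nlin, of 1] by auto
  define f where "f = \<Phi> ?E"
  have EA: "?E \<in> Aut0 n" using i M by (intro elem_single_mem)
  have GA: "?G \<in> Aut0 n" using j N N0 by (intro elem_single_mem)
  have fA: "f \<in> Aut0 n" unfolding f_def using EA by (rule \<Phi>_mem)
  have f: "alg_endo n f" using fA by (rule Aut0_imp_alg_endo)
  have NP: "single ?N e \<in> Pn n" for e :: 'a using N by (intro Pn_single) auto
  \<comment> \<open>Neither map changes the polynomial of the other: \<open>?N\<close> is free of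
    \<open>x_i\<close>, and \<open>?M\<close> is free of \<open>x_j\<close>.\<close>
  have "?E \<circ> ?G = ?G \<circ> ?E"
  proof -
    have "i \<notin> mvars (single ?N (1::'a))" using mvars_single[of ?N "1::'a"] Nkeys k l by auto
    then have "?E (single ?N 1) = single ?N 1" using NP by (intro elem_ident)
    moreover have "j \<notin> mvars (single ?M c)" using mvars_single[of ?M c] j by auto
    ultimately show ?thesis
      using elem_elem[of i n j "single ?M c" "single ?N 1"] i j NP Pn_single[of ?M n c] k by simp
  qed
  then have "f \<circ> elem n j (single ?N b) = elem n j (single ?N b) \<circ> f"
    using \<Phi>_comp[OF EA GA] \<Phi>_comp[OF GA EA] b by (simp add: f_def)
  then have comm: "f (elem n j (single ?N b) (mVar j)) = elem n j (single ?N b) (f (mVar j))"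
    by (metis comp_apply)
  define mu where "mu h = lookup (f (mVar h)) (single h 1)" for h
  have diag: "f (mVar h) = mConst (mu h) * mVar h" if "h < n" "h \<noteq> i" "h \<noteq> k" for h
  proof -
    have "?M \<noteq> single h 1" using that by (metis lookup_single_eq lookup_single_not_eq zero_neq_one)
    then have "keys (f (mVar h)) \<subseteq> {single h 1}"
      using image_keys[OF i M that(1), of c] that by (simp add: f_def)
    from eq_single_if_keys[OF this] show ?thesis by (simp add: mu_def mConst_mVar)
  qed
  have mul: "mu l \<noteq> 0"
  proof
    assume "mu l = 0"
    then have "f (mVar l) = f 0" using diag[of l] l alg_endo_0[OF f] by simp
    from Aut0_inj[OF fA _ _ this] have "mVar l = (0 :: 'a mpoly)" using l by simp
    then show False using mVar_nonzero[of l, where 'a='a] by simp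
  qed
  have N_eq: "single ?N b = mConst b * (mVar k * mVar l)"
    by (simp add: mVar_def mult_single mConst_mult_single)
  have "f (mVar j + single ?N b) = mConst (mu j) * mVar j + mConst b * (f (mVar k) * f (mVar l))"
    unfolding N_eq using j k l diag[of j]
    by (simp add: alg_endo_add[OF f] alg_endo_mult[OF f] alg_endo_mConst[OF f] Pn_mult)
  moreover have "elem n j (single ?N b) (f (mVar j)) = mConst (mu j) * (mVar j + single ?N b)"
    using j diag[of j] NP[of b]
    by (simp add: alg_endo_mult[OF alg_endo_elem] alg_endo_mConst[OF alg_endo_elem] elem_mVar)
  ultimately have "mConst b * (f (mVar k) * f (mVar l)) = mConst (mu j) * single ?N b"
    using comm j by (simp add: elem_mVar ring_distribs)
  \<comment> \<open>The coefficient of \<open>x_i x_l\<close>: on the left it is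
    \<open>b * mu l\<close> times the unwanted coefficient of \<open>x_i\<close> in
    \<open>f (mVar k)\<close>, on the right it is \<open>0\<close>.\<close>
  then have eq: "b * lookup (f (mVar k) * f (mVar l)) (single i 1 + single l 1)
      = mu j * lookup (single ?N b) (single i 1 + single l 1)"
    by (metis lookup_mConst_mult)
  have "f (mVar l) = single (single l 1) (mu l)"
    using diag[of l] l by (simp add: mConst_mVar)
  moreover have "?N \<noteq> single i 1 + single l 1"
    using k by (metis add_right_cancel lookup_single_eq lookup_single_not_eq zero_neq_one)
  ultimately have "lookup (f (mVar k)) (single i 1) = 0"
    using eq b mul by (simp add: lookup_mult_single lookup_single)
  then have "single i 1 \<notin> keys (f (mVar k))" by (simp add: in_keys_iff)
  then show ?thesis using image_keys[OF i M k(1), of c] k by (auto simp: f_def)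
qed

text \<open>The \<open>b_i(M)\<close> of the overview. The choice is meaningful for nonzero
  \<open>M\<close> free of \<open>x_i\<close>, where \<open>image_elem_one\<close> shows that such a
  \<open>b\<close> exists.\<close>

definition factor :: "nat \<Rightarrow> (nat \<Rightarrow>\<^sub>0 nat) \<Rightarrow> 'a" where
  "factor i M = (SOME b. \<Phi> (elem n i (single M 1)) = elem n i (single M b))"

context
  fixes i :: nat and M :: "nat \<Rightarrow>\<^sub>0 nat"
  assumes i: "i < n" and M: "keys M \<subseteq> {..<n} - {i}" "M \<noteq> 0"
begin

lemma image_elem_one: "\<Phi> (elem n i (single M 1)) = elem n i (single M (factor i M))"
proof -
  have "\<exists>b. \<Phi> (elem n i (single M 1)) = elem n i (single M b)"
  proof (rule image_eq_elem[OF i M])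
    fix k assume k: "k < n" "k \<noteq> i"
    show "keys (\<Phi> (elem n i (single M 1)) (mVar k)) \<subseteq> {single k 1}"
      using image_keys[OF i M k(1), of 1] image_linear_keys[OF i k] k by (cases "M = single k 1") auto
  qed
  then show ?thesis unfolding factor_def by (rule someI_ex)
qed

lemma factor_nonzero: "factor i M \<noteq> 0"
proof
  assume "factor i M = 0"
  then have "\<Phi> (elem n i (single M 1)) = \<Phi> id" using image_elem_one i by (simp add: elem_zero \<Phi>_id)
  then have "elem n i (single M (1::'a)) = id"
    by (rule \<Phi>_inj[OF elem_single_mem[OF i M] id_mem_Aut0])
  then show False using elem_single_eq_id[OF i M] by fastforce
qed

text \<open>Scaling \<open>x_i\<close> by \<open>1 / c\<close> conjugates \<open>e(i, M)\<close> to
  \<open>e(i, c M)\<close>. As \<open>\<Phi>\<close> fixes this torus element, the image for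
  coefficient \<open>c\<close> follows from that for \<open>1\<close>.\<close>

lemma image_elem_single: "\<Phi> (elem n i (single M c)) = elem n i (single M (factor i M * c))"
proof (cases "c = 0")
  case True
  then show ?thesis using i by (simp add: elem_zero \<Phi>_id)
next
  case False
  define lam where "lam = (\<lambda>l. if l = i then 1 / c else 1)"
  let ?T = "torus_elt n lam"
  have nz: "lam l \<noteq> 0" for l using False by (simp add: lam_def)
  have T: "?T \<in> Aut0 n" using nz by (intro torus_elt_mem_Aut0)
  have conj: "?T \<circ> elem n i (single M e) = elem n i (single M (e * c)) \<circ> ?T" for e
    using i single_monomial_mem_Pn[OF i M] lookup_monomial_own_var[OF i M] False
    by (intro torus_elt_comp_elem) (auto simp: lookup_single when_def lam_def mpow_one_var)
  have "\<Phi> (elem n i (single M c)) \<circ> ?T = \<Phi> (?T \<circ> elem n i (single M 1))"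
    using \<Phi>_comp[OF elem_single_mem[OF i M] T, of c] fixes_torus[of lam] nz conj[of 1] by simp
  also have "\<dots> = elem n i (single M (factor i M * c)) \<circ> ?T"
    using \<Phi>_comp[OF T elem_single_mem[OF i M], of 1] fixes_torus[of lam] nz image_elem_one conj by simp
  finally have "\<Phi> (elem n i (single M c)) \<circ> (?T \<circ> torus_elt n (\<lambda>i. 1 / lam i))
      = elem n i (single M (factor i M * c)) \<circ> (?T \<circ> torus_elt n (\<lambda>i. 1 / lam i))"
    by (simp only: comp_assoc[symmetric])
  then show ?thesis using torus_elt_inverse(1)[of n lam] nz by simp
qed

end

section \<open>Images of arbitrary elementary automorphisms\<close>

definition rescale :: "nat \<Rightarrow> 'a mpoly \<Rightarrow> 'a mpoly" where
  "rescale i P = Poly_Mapping.mapp (\<lambda>m c. factor i m * c) P"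

lemma lookup_rescale: "lookup (rescale i P) m = factor i m * lookup P m"
  by (simp add: rescale_def lookup_mapp when_def in_keys_iff)

lemma rescale_add: "rescale i (P + Q) = rescale i P + rescale i Q"
  by (rule poly_mapping_eqI) (simp add: lookup_rescale lookup_add ring_distribs)

lemma rescale_single: "rescale i (single m c) = single m (factor i m * c)"
  by (rule poly_mapping_eqI) (simp add: lookup_rescale lookup_single when_def)

lemma rescale_admissible: "P \<in> admissible n i \<Longrightarrow> rescale i P \<in> admissible n i"
  using keys_mapp_subset[of "\<lambda>m c. factor i m * c" P] by (auto simp: admissible_iff rescale_def)

text \<open>\<open>e(i, P + Q)\<close> is the composite of \<open>e(i, P)\<close> and
  \<open>e(i, Q)\<close>, so the image is determined term by term.\<close>

lemma image_elem:
  assumes i: "i < n" and P: "P \<in> admissible n i"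
  shows "\<Phi> (elem n i P) = elem n i (rescale i P)"
proof -
  from P have "keys P \<subseteq> {m. keys m \<subseteq> {..<n} - {i} \<and> m \<noteq> 0}" by (auto simp: admissible_iff)
  then show ?thesis
  proof (induction P rule: poly_mapping_induct_keys)
    case zero
    have "rescale i 0 = 0" by (rule poly_mapping_eqI) (simp add: lookup_rescale)
    then show ?case by (simp only: elem_zero[OF i] \<Phi>_id)
  next
    case (add m c p)
    then have m: "keys m \<subseteq> {..<n} - {i}" "m \<noteq> 0" and p: "p \<in> admissible n i"
      by (auto simp: admissible_iff)
    have mc: "single m e \<in> admissible n i" for e :: 'a using m by (intro admissible_single)
    have "\<Phi> (elem n i (single m c + p)) = \<Phi> (elem n i (single m c)) \<circ> \<Phi> (elem n i p)"
      using \<Phi>_comp[OF elem_mem_Aut0[OF i mc] elem_mem_Aut0[OF i p]] elem_comp[OF i mc p] by simp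
    also have "\<dots> = elem n i (single m (factor i m * c)) \<circ> elem n i (rescale i p)"
      using image_elem_single[OF i m] add by simp
    also have "\<dots> = elem n i (rescale i (single m c + p))"
      using elem_comp[OF i mc rescale_admissible[OF p]] by (simp add: rescale_add rescale_single)
    finally show ?case .
  qed
qed

text \<open>Compare the coefficients of \<open>q m\<^sup>d\<close> in \<open>q (x\<^sub>i + m)\<^sup>d\<close>, the polynomial of the conjugate of
  \<open>x\<^sub>j \<mapsto> x\<^sub>j + q x\<^sub>i\<^sup>d\<close> by \<open>x\<^sub>i \<mapsto> x\<^sub>i + m\<close>.\<close>

lemma factor_rel:
  assumes ij: "i < n" "j < n" "i \<noteq> j"
    and q: "keys q \<subseteq> {..<n} - {i, j}" and m: "keys m \<subseteq> {..<n} - {i, j}" "m \<noteq> 0" and d: "d > 0"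
  shows "factor j (q + mscale d m) = factor j (q + single i d) * factor i m ^ d"
proof -
  let ?A = "single m (1::'a)" and ?Q = "q + single i d"
  let ?B = "single ?Q (1::'a)"
  have Q: "keys ?Q \<subseteq> {..<n} - {j}"
    using q ij keys_add[of q "single i d"] by (auto split: if_splits)
  have "lookup ?Q i \<noteq> 0" using d by (simp add: lookup_add)
  then have Q0: "?Q \<noteq> 0" by (metis lookup_zero)
  have A: "single m e \<in> admissible n i" for e :: 'a using m by (intro admissible_single) auto
  have B: "single ?Q e \<in> admissible n j" for e :: 'a using Q Q0 by (intro admissible_single)
  have AP: "single m e \<in> Pn n" "j \<notin> mvars (single m e)" for e :: 'a
    using m mvars_single[of m e] by (auto intro!: Pn_single)
  have BP: "single ?Q e \<in> Pn n" for e :: 'a using B by (simp add: admissible_def)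
  define R where "R = elem n i ?A ?B"
  \<comment> \<open>Substituting \<open>x_i + m\<close> introduces no \<open>x_j\<close> and
    preserves the origin, so \<open>image_elem\<close> applies to \<open>R\<close>.\<close>
  have R: "R \<in> admissible n j"
  proof -
    have "mvars R \<subseteq> (\<Union>k\<in>mvars ?B. mvars (if k = i then mVar i + ?A else mVar k))"
      unfolding R_def elem_eq_sub[OF BP] by (rule mvars_sub)
    moreover have "j \<notin> mvars (if k = i then mVar i + ?A else mVar k)" if "k \<in> mvars ?B" for k
    proof -
      have "k \<noteq> j" using that B by (auto simp: admissible_def)
      then show ?thesis using mvars_add[of "mVar i" ?A] AP(2)[of 1] ij by auto
    qed
    ultimately have "j \<notin> mvars R" by blast
    moreover have "R \<in> Pn n"
      unfolding R_def by (rule alg_endo_mem_Pn[OF alg_endo_elem[OF ij(1) AP(1)] BP])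
    moreover have "const_coeff R = const_coeff ?B"
      unfolding R_def using elem_mem_Aut0[OF ij(1) A]
      by (intro alg_endo_const_coeff[OF _ _ BP]) (auto simp: Aut0_def)
    ultimately show ?thesis using B by (simp add: admissible_def)
  qed
  have EA: "elem n i ?A \<in> Aut0 n" using ij A by (intro elem_mem_Aut0)
  let ?A' = "single m (factor i m)" and ?B' = "single ?Q (factor j ?Q)"
  have "\<Phi> (elem n i ?A) \<circ> \<Phi> (elem n j ?B) = \<Phi> (elem n j R) \<circ> \<Phi> (elem n i ?A)"
    using \<Phi>_comp[OF EA elem_mem_Aut0[OF ij(2) B]] \<Phi>_comp[OF elem_mem_Aut0[OF ij(2) R] EA]
      elem_elem[OF ij AP BP] by (simp add: R_def)
  then have "elem n i ?A' \<circ> elem n j ?B' = elem n j (rescale j R) \<circ> elem n i ?A'"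
    using image_elem[OF ij(1) A] image_elem[OF ij(2) B] image_elem[OF ij(2) R]
    by (simp add: rescale_single)
  then have "elem n j (elem n i ?A' ?B') \<circ> elem n i ?A' = elem n j (rescale j R) \<circ> elem n i ?A'"
    using elem_elem[OF ij AP BP] by simp
  \<comment> \<open>Evaluation at \<open>x_j\<close>, which \<open>e(i, ?A')\<close> fixes, recovers
    the two polynomials.\<close>
  from fun_cong[OF this, of "mVar j"]
  have "elem n j (elem n i ?A' ?B') (mVar j) = elem n j (rescale j R) (mVar j)"
    using ij by (simp add: elem_mVar)
  then have "elem n i ?A' ?B' = rescale j R" using ij by (simp add: elem_mVar)
  \<comment> \<open>The left coefficient is \<open>factor j ?Q * factor i m ^ d\<close>, and the
    coefficient in \<open>R\<close> is \<open>1\<close>.\<close>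
  then have "lookup (elem n i ?A' ?B') (q + mscale d m) = factor j (q + mscale d m) * lookup R (q + mscale d m)"
    by (simp add: lookup_rescale)
  moreover have "keys q \<subseteq> {..<n} - {i}" "keys m \<subseteq> {..<n} - {i}" using q m by auto
  ultimately show ?thesis
    by (simp add: R_def lookup_elem_single[OF ij(1)])
qed

end

section \<open>Scaling factors of monomials\<close>

lemma exponent_induct [consumes 1, case_names zero add]:
  fixes m :: "'b \<Rightarrow>\<^sub>0 nat"
  assumes "keys m \<subseteq> A"
    and zero: "P 0"
    and add: "\<And>k m. k \<in> A \<Longrightarrow> keys m \<subseteq> A \<Longrightarrow> P m \<Longrightarrow> P (single k 1 + m)"
  shows "P m"
  using assms(1)
proof (induction m rule: poly_mapping_induct_keys)
  case (add k c m)
  have "keys (single k c + m) \<subseteq> A \<and> P (single k c + m)"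
  proof (induction c)
    case (Suc c)
    have "single k (Suc c) + m = single k 1 + (single k c + m)"
      by (simp add: add.assoc[symmetric] flip: single_add)
    moreover have "keys (single k 1 + (single k c + m)) \<subseteq> A"
      using Suc add(1) keys_add[of "single k 1" "single k c + m"] by auto
    ultimately show ?case using Suc assms(3)[OF add(1)] by simp
  qed (use add in simp)
  then show ?case ..
qed (rule zero)

text \<open>The relation of \<open>factor_rel\<close> detached from automorphisms: what follows
  concerns scalars indexed by monomials. The conditions on \<open>m\<close> and \<open>d\<close>
  keep the arbitrary values at exponent \<open>0\<close> out.\<close>

definition transvection_compatible :: "nat \<Rightarrow> (nat \<Rightarrow> (nat \<Rightarrow>\<^sub>0 nat) \<Rightarrow> 'a::field) \<Rightarrow> bool" where
  "transvection_compatible n a \<longleftrightarrow>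
     (\<forall>i<n. \<forall>j<n. \<forall>q m d. i \<noteq> j \<longrightarrow> keys q \<subseteq> {..<n} - {i, j} \<longrightarrow> keys m \<subseteq> {..<n} - {i, j} \<longrightarrow>
        m \<noteq> 0 \<longrightarrow> d > 0 \<longrightarrow> a j (q + mscale d m) = a j (q + single i d) * a i m ^ d)"

text \<open>The normalisation spreads in stages: to all quadratic monomials, to monomials missing a
  further variable \<open>x_i\<close>, and then to the rest by trading the power of
  \<open>x_i\<close> for one of another variable.\<close>

lemma transvection_compatible_trivial:
  fixes a :: "nat \<Rightarrow> (nat \<Rightarrow>\<^sub>0 nat) \<Rightarrow> 'a::field"
  assumes n: "n > 3" and a: "transvection_compatible n a"
    and lin: "\<And>j k. j < n \<Longrightarrow> k < n \<Longrightarrow> j \<noteq> k \<Longrightarrow> a j (single k 1) = 1"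
    and quad: "a 0 (single 1 1 + single 2 1) = 1"
    and j: "j < n" and m: "keys m \<subseteq> {..<n} - {j}" "m \<noteq> 0"
  shows "a j m = 1"
proof -
  have rel: "a j (q + mscale d m) = a j (q + single i d) * a i m ^ d"
    if "i < n" "j < n" "i \<noteq> j" "keys q \<subseteq> {..<n} - {i, j}" "keys m \<subseteq> {..<n} - {i, j}" "m \<noteq> 0" "d > 0"
    for i j q m d
    using a that unfolding transvection_compatible_def by blast
  have rel1: "a j (q + m) = a j (q + single i 1) * a i m"
    if "i < n" "j < n" "i \<noteq> j" "keys q \<subseteq> {..<n} - {i, j}" "keys m \<subseteq> {..<n} - {i, j}" "m \<noteq> 0"
    for i j q m
    using rel[OF that, of 1] by simp
  \<comment> \<open>Take \<open>m = x_k\<close>, where \<open>a i\<close> is \<open>1\<close>: a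
    power of \<open>x_k\<close> can be traded for that of \<open>x_i\<close> if \<open>q\<close> is
    free of \<open>x_i\<close>.\<close>
  have move: "a j (q + single k d) = a j (q + single i d)"
    if "i < n" "j < n" "k < n" "i \<noteq> j" "k \<noteq> i" "k \<noteq> j" "keys q \<subseteq> {..<n} - {i, j}" "d > 0" for i j k q d
    using rel[of i j q "single k 1" d] lin[of i k] that by (simp add: mscale_single)
  note fresh = ex_fresh_index[OF n]
  have quad_move: "a j (single l 1 + single k 1) = a j (single l 1 + single k' 1)"
    if l: "l < n" "l \<noteq> j" and k: "k < n" "k \<noteq> j" and k': "k' < n" "k' \<noteq> j" and j: "j < n" for j k k' l
  proof -
    \<comment> \<open>Both sides are compared with \<open>x_l x_i\<close> for a further index
      \<open>i\<close>; squares, \<open>k = l\<close>, are included.\<close>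
    obtain i where i: "i < n" "i \<noteq> j" "i \<noteq> l" using fresh by blast
    have "a j (single l 1 + single k 1) = a j (single l 1 + single i 1)" if "k < n" "k \<noteq> j" for k
      using move[of i j k "single l 1" 1] i l j that by (cases "k = i") auto
    then show ?thesis using k k' by simp
  qed
  have quad_eq: "a j (single k 1 + single l 1) = a j (single k' 1 + single l' 1)"
    if "k < n" "k \<noteq> j" "l < n" "l \<noteq> j" "k' < n" "k' \<noteq> j" "l' < n" "l' \<noteq> j" "j < n" for j k l k' l'
    using quad_move[of k j l k'] quad_move[of k' j k l'] that by (simp add: add.commute)
  have quad_one: "a j (single k 1 + single l 1) = 1"
    if "k < n" "k \<noteq> j" "l < n" "l \<noteq> j" "j < n" for j k l
  proof -
    have zero: "a 0 (single k 1 + single l 1) = 1" if "k < n" "k \<noteq> 0" "l < n" "l \<noteq> 0" for k l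
      using quad_eq[of k 0 l 1 2] that n quad by simp
    show ?thesis
    proof (cases "j = 0")
      case False
      obtain h where h: "h < n" "h \<noteq> 0" "h \<noteq> j" using fresh by blast
      \<comment> \<open>With \<open>q = 0\<close> and \<open>m = x_h^2\<close> the relation carries
        the value \<open>1\<close> from direction \<open>0\<close> to direction
        \<open>j\<close>.\<close>
      have "a j (0 + (single h 1 + single h 1)) = a j (0 + single 0 1) * a 0 (single h 1 + single h 1)"
        using h that False n by (intro rel1) (auto simp flip: single_add)
      then have "a j (single h 1 + single h 1) = 1"
        using lin[of j 0] zero[of h h] h that False n by simp
      then show ?thesis using quad_eq[of k j l h h] that h by simp
    qed (use that zero in simp)
  qed
  \<comment> \<open>Directions \<open>i\<close> and \<open>j\<close> go through the induction
    together: prefixing \<open>x_k\<close> in one uses the value at \<open>m\<close> in the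
    other.\<close>
  have missing: "m = 0 \<or> a i m = 1 \<and> a j m = 1"
    if ij: "i < n" "j < n" "i \<noteq> j" and m: "keys m \<subseteq> {..<n} - {i, j}" for i j m
    using m
  proof (induction m rule: exponent_induct)
    case (add k m)
    then have k: "k < n" "k \<noteq> i" "k \<noteq> j" by auto
    show ?case
    proof (cases "m = 0")
      case False
      with add have IH: "a i m = 1" "a j m = 1" by auto
      have "a j (single k 1 + m) = a j (single k 1 + single i 1) * a i m"
        using ij k add(2) False by (intro rel1) auto
      moreover have "a i (single k 1 + m) = a i (single k 1 + single j 1) * a j m"
        using ij k add(2) False by (intro rel1) auto
      ultimately show ?thesis using IH ij k quad_one[of k j i] quad_one[of k i j] by simp
    qed (use ij k lin in auto)
  qed simp
  obtain i where i: "i < n" "i \<noteq> j" using fresh by blast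
  obtain k where k: "k < n" "k \<noteq> j" "k \<noteq> i" using fresh by blast
  show ?thesis
  proof (cases "lookup m i = 0")
    case True
    then have "keys m \<subseteq> {..<n} - {i, j}" using m by (auto simp: in_keys_iff)
    then show ?thesis using missing[of i j m] i j m by auto
  next
    case False
    define q where "q = Poly_Mapping.update i 0 m"
    have m_eq: "m = q + single i (lookup m i)"
      by (rule poly_mapping_eqI) (simp add: q_def lookup_add lookup_update lookup_single when_def)
    have q: "keys q \<subseteq> {..<n} - {i, j}"
      using m by (auto simp: q_def keys_update)
    \<comment> \<open>Trading \<open>x_i\<close> for \<open>x_k\<close> yields a monomial free of
      \<open>x_i\<close>, already covered by \<open>missing\<close>.\<close>
    have "a j m = a j (q + single k (lookup m i))"
      using move[of i j k q "lookup m i"] i j k q False m_eq by simp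
    moreover have "keys (q + single k (lookup m i)) \<subseteq> {..<n} - {i, j}"
      using q k keys_add[of q "single k (lookup m i)"] by (auto split: if_splits)
    moreover have "q + single k (lookup m i) \<noteq> 0"
      using False by (auto simp: poly_mapping_eq_iff fun_eq_iff lookup_add intro!: exI[of _ k])
    ultimately show ?thesis using missing[of i j] i j by auto
  qed
qed

text \<open>A torus element \<open>s\<close> gives the compatible family \<open>s^m / s_i\<close>.
  Choose \<open>s\<close> to match \<open>b\<close> on linear monomials and one quadratic one; the
  quotient is then normalised, hence trivial.\<close>

lemma transvection_compatible_imp_torus:
  fixes b :: "nat \<Rightarrow> (nat \<Rightarrow>\<^sub>0 nat) \<Rightarrow> 'a::field"
  assumes n: "n > 3" and b: "transvection_compatible n b"
    and nz: "\<And>i m. i < n \<Longrightarrow> keys m \<subseteq> {..<n} - {i} \<Longrightarrow> m \<noteq> 0 \<Longrightarrow> b i m \<noteq> 0"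
  obtains s where "\<And>i. i < n \<Longrightarrow> s i \<noteq> 0"
    and "\<And>i m. i < n \<Longrightarrow> keys m \<subseteq> {..<n} - {i} \<Longrightarrow> m \<noteq> 0 \<Longrightarrow> b i m * s i = mpow s m"
proof -
  \<comment> \<open>The linear values prescribe the ratios \<open>s_k / s_0 = b_0(x_k)\<close>;
    \<open>r\<close> is the solution with \<open>r 0 = 1\<close>, unique up to a common
    scalar.\<close>
  define r where "r k = (if k = 0 then 1 else b 0 (single k 1))" for k
  \<comment> \<open>The common scalar is forced by
    \<open>b_0(x_1 x_2) = s_1 s_2 / s_0 = \<alpha> r_1 r_2\<close>.\<close>
  define \<alpha> where "\<alpha> = b 0 (single 1 1 + single 2 1) / (r 1 * r 2)"
  define s where "s k = \<alpha> * r k" for k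
  define a where "a j m = b j m * s j / mpow s m" for j m
  have r: "r k \<noteq> 0" if "k < n" for k
    using that n nz[of 0 "single k 1"] by (auto simp: r_def)
  have \<alpha>: "\<alpha> \<noteq> 0"
  proof -
    have "lookup (single 1 1 + single 2 1 :: nat \<Rightarrow>\<^sub>0 nat) 1 \<noteq> 0" by (simp add: lookup_add lookup_single)
    then have "single 1 1 + single 2 1 \<noteq> (0 :: nat \<Rightarrow>\<^sub>0 nat)" by auto
    then have "b 0 (single 1 1 + single 2 1) \<noteq> 0"
      using n keys_add[of "single (1::nat) 1" "single 2 (1::nat)"] by (intro nz) auto
    then show ?thesis using r[of 1] r[of 2] n by (simp add: \<alpha>_def)
  qed
  have s: "s k \<noteq> 0" if "k < n" for k
    using that r \<alpha> by (simp add: s_def)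
  have s_mpow: "mpow s m \<noteq> 0" if "keys m \<subseteq> {..<n}" for m
    using that s by (intro mpow_nonzero) auto
  have brel: "b j (single k 1) = b j (single i 1) * b i (single k 1)"
    if "i < n" "j < n" "k < n" "i \<noteq> j" "k \<noteq> i" "k \<noteq> j" for i j k
  proof -
    have "b j (0 + mscale 1 (single k 1)) = b j (0 + single i 1) * b i (single k 1) ^ 1"
      by (rule b[unfolded transvection_compatible_def, rule_format]) (use that in auto)
    then show ?thesis by (simp add: mscale_single)
  qed
  have blin: "b j (single k 1) * r j = r k" if jk: "j < n" "k < n" "j \<noteq> k" for j k
  proof -
    consider "j = 0" | "k = 0" | "j \<noteq> 0" "k \<noteq> 0" by blast
    then show ?thesis
    proof cases
      case 1
      then show ?thesis using jk by (simp add: r_def)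
    next
      case 2
      \<comment> \<open>\<open>brel\<close> needs three distinct indices, so
        \<open>b_j(x_0) b_0(x_j) = 1\<close> is obtained by going from \<open>j\<close> to
        \<open>0\<close> and back at the monomial \<open>x_h\<close>.\<close>
      define h where "h = (if j = 1 then 2 else 1 :: nat)"
      have h: "h < n" "h \<noteq> 0" "h \<noteq> j" using n by (auto simp: h_def)
      have "b j (single h 1) = b j (single 0 1) * b 0 (single h 1)"
        "b 0 (single h 1) = b 0 (single j 1) * b j (single h 1)"
        using brel[of 0 j h] brel[of j 0 h] jk h 2 n by simp_all
      moreover have "b j (single h 1) \<noteq> 0" using jk h by (intro nz) auto
      ultimately have "b j (single 0 1) * b 0 (single j 1) = 1"
        by (auto simp: mult.commute)
      then show ?thesis using 2 jk by (simp add: r_def)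
    next
      case 3
      then show ?thesis using brel[of j 0 k] jk n by (simp add: r_def mult.commute)
    qed
  qed
  have "a j m = 1" if "j < n" "keys m \<subseteq> {..<n} - {j}" "m \<noteq> 0" for j m
  proof (rule transvection_compatible_trivial[OF n _ _ _ that])
    \<comment> \<open>The family \<open>s^m / s_i\<close> satisfies the relation, as the powers of
      \<open>s_i\<close> cancel; hence so does the quotient.\<close>
    show "transvection_compatible n a"
      unfolding transvection_compatible_def
    proof (intro allI impI)
      fix i j d :: nat and q m :: "nat \<Rightarrow>\<^sub>0 nat"
      assume *: "i < n" "j < n" "i \<noteq> j" "keys q \<subseteq> {..<n} - {i, j}" "keys m \<subseteq> {..<n} - {i, j}"
        "m \<noteq> 0" "d > 0"
      then have "b j (q + mscale d m) = b j (q + single i d) * b i m ^ d"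
        using b unfolding transvection_compatible_def by blast
      moreover have "mpow s q \<noteq> 0" "mpow s m \<noteq> 0" "s i \<noteq> 0" using * s by (auto intro!: s_mpow)
      ultimately show "a j (q + mscale d m) = a j (q + single i d) * a i m ^ d"
        by (simp add: a_def mpow_add mpow_mscale power_mult_distrib power_divide)
    qed
    show "a j (single k 1) = 1" if "j < n" "k < n" "j \<noteq> k" for j k
      using blin[OF that] s[of k] that r[of k] \<alpha> by (simp add: a_def s_def mult.left_commute)
    show "a 0 (single 1 1 + single 2 1) = 1"
      using \<alpha> r[of 1] r[of 2] n by (simp add: a_def mpow_add s_def \<alpha>_def r_def[of 0])
  qed
  then have "b i m * s i = mpow s m" if "i < n" "keys m \<subseteq> {..<n} - {i}" "m \<noteq> 0" for i m
    using that s_mpow[of m] by (auto simp: a_def field_simps)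
  with s that show ?thesis by blast
qed

section \<open>The conjugating torus element\<close>

lemma (in torus_fixing) ex_torus_conjugation:
  "\<exists>S\<in>GL_lin n. \<forall>E\<in>elementary n.
     S \<otimes>\<^bsub>Aut0_group n\<^esub> \<Phi> E \<otimes>\<^bsub>Aut0_group n\<^esub> inv\<^bsub>Aut0_group n\<^esub> S = E"
proof -
  have "transvection_compatible n factor"
    unfolding transvection_compatible_def by (intro allI impI factor_rel)
  then obtain s where s: "\<And>i. i < n \<Longrightarrow> s i \<noteq> 0"
    and factor: "\<And>i m. i < n \<Longrightarrow> keys m \<subseteq> {..<n} - {i} \<Longrightarrow> m \<noteq> 0 \<Longrightarrow> factor i m * s i = mpow s m"
    by (rule transvection_compatible_imp_torus[OF n]) (auto simp: factor_nonzero)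
  \<comment> \<open>Conjugation by this element multiplies the term \<open>M\<close> of
    \<open>e(i, P)\<close> by \<open>s_i / s^M\<close>, the inverse of
    \<open>factor i M\<close>.\<close>
  define lam where "lam = (\<lambda>i. 1 / s i)"
  let ?S = "torus_elt n lam" and ?S' = "torus_elt n (\<lambda>i. 1 / lam i)"
  have lam: "lam i \<noteq> 0" if "i < n" for i using s[OF that] by (simp add: lam_def)
  have S: "?S \<in> Aut0 n" "?S' \<in> Aut0 n" using lam by (auto intro!: torus_elt_mem_Aut0)
  interpret monoid "Aut0_group n" by (rule monoid_Aut0_group)
  have inv: "inv\<^bsub>Aut0_group n\<^esub> ?S = ?S'"
    using inv_unique'[of ?S ?S'] S torus_elt_inverse[of n lam] lam by (simp add: Aut0_group_def)
  have "?S \<circ> \<Phi> E \<circ> ?S' = E" if "E \<in> elementary n" for E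
  proof -
    from that obtain i P where E: "E = elem n i P" and i: "i < n" and P: "P \<in> admissible n i"
      by (auto simp: elementary_eq)
    have "mpow lam m * lookup (rescale i P) m = lam i * lookup P m" for m
    proof (cases "m \<in> keys P")
      case True
      then have m: "keys m \<subseteq> {..<n} - {i}" "m \<noteq> 0" using P by (auto simp: admissible_iff)
      have "mpow lam m * mpow s m = mpow (\<lambda>_. 1) m"
        unfolding mpow_mult[symmetric] using m s by (intro mpow_cong) (auto simp: lam_def)
      then have "mpow lam m * (factor i m * s i) = 1" using factor[OF i m] by simp
      then have "mpow lam m * factor i m = lam i"
        using s[OF i] by (simp add: lam_def field_simps)
      then show ?thesis by (simp add: lookup_rescale mult.assoc[symmetric])
    qed (simp add: lookup_rescale in_keys_iff)
    then have "?S \<circ> elem n i (rescale i P) = elem n i P \<circ> ?S"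
      using P rescale_admissible[OF P] by (intro torus_elt_comp_elem[OF i]) (auto simp: admissible_def)
    then have "?S \<circ> \<Phi> E \<circ> ?S' = E \<circ> (?S \<circ> ?S')"
      by (simp only: E image_elem[OF i P] comp_assoc[symmetric])
    then show ?thesis using torus_elt_inverse(1)[of n lam] lam by simp
  qed
  then show ?thesis
    using torus_elt_mem_GL_lin[of n lam] lam inv
    by (intro bexI[of _ ?S]) (auto simp: Aut0_group_def)
qed

theorem mainTheorem1:
  fixes \<Phi> :: "('a::field mpoly \<Rightarrow> 'a mpoly) \<Rightarrow> ('a mpoly \<Rightarrow> 'a mpoly)"
    and n :: nat
  assumes "alg_closed_field TYPE('a)"
    and "CHAR('a) > 0" and "CHAR('a) \<noteq> 2"
    and "n > 3"
    and "\<Phi> \<in> iso (Aut0_group n) (Aut0_group n)"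
    and "\<forall>lam. (\<forall>i<n. lam i \<noteq> 0) \<longrightarrow> \<Phi> (torus_elt n lam) = torus_elt n lam"
  shows "\<exists>S\<in>GL_lin n. \<forall>E\<in>elementary n.
           S \<otimes>\<^bsub>Aut0_group n\<^esub> \<Phi> E \<otimes>\<^bsub>Aut0_group n\<^esub> inv\<^bsub>Aut0_group n\<^esub> S = E"
proof -
  \<comment> \<open>If \<open>2 = 0\<close>, the characteristic divides \<open>2\<close>; the value
    \<open>1\<close> would mean \<open>1 = 0\<close>, and \<open>2\<close> is excluded.\<close>
  have two: "(2::'a) \<noteq> 0"
  proof
    assume "(2::'a) = 0"
    then have "of_nat 2 = (0::'a)" by simp
    then have "CHAR('a) dvd 2" by (simp only: of_nat_eq_0_iff_char_dvd)
    then have "CHAR('a) \<le> 2" by (rule dvd_imp_le) simp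
    moreover have "CHAR('a) \<noteq> 1" using of_nat_CHAR[where 'a='a] by auto
    ultimately show False using assms(2,3) by linarith
  qed
  have root: "\<exists>t::'a. t \<noteq> 0 \<and> t ^ d \<noteq> 1" if d: "d > 0" for d
  proof -
    \<comment> \<open>The witness is a root \<open>t\<close> of \<open>X^d - 2\<close>: the value
      \<open>t ^ d = 2\<close> differs from \<open>1\<close>, and from \<open>0\<close>, so
      \<open>t\<close> is nonzero.\<close>
    have "degree (monom 1 d + [:- 2::'a:]) = d"
      using d by (subst degree_add_eq_left) (auto simp: degree_monom_eq)
    then obtain t :: 'a where "poly (monom 1 d + [:- 2:]) t = 0"
      using assms(1) d unfolding alg_closed_field_def by (metis Suc_leI One_nat_def)
    then have "t ^ d = 2" by (simp add: poly_monom)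
    moreover have "(2::'a) \<noteq> 1"
    proof
      assume "(2::'a) = 1"
      then have "(1::'a) + 1 = 1 + 0" by simp
      then show False by (simp only: add_left_cancel one_neq_zero)
    qed
    ultimately show ?thesis using two d by (intro exI[of _ t]) (auto simp: zero_power)
  qed
  interpret torus_fixing \<Phi> n
    using assms two root by unfold_locales auto
  show ?thesis by (rule ex_torus_conjugation)
qed

end
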